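(* Let $M$ be a $C^{\infty}$ smooth paracompact manifold without boundary and let $1\leq r\leq\infty$. Let $\beta_M:\mathfrak{G}^r(M)\to\mathfrak{F}^r(M)$, $G\mapsto\mathcal{F}_G$, be the map assigning to an isotopically connected group the foliation it determines, and let $\alpha_M:\mathfrak{F}^r(M)\to\mathfrak{G}^r_c(M)$, $\mathcal{F}\mapsto G_{\mathcal{F}}:=\mathrm{Diff}^r_c(M,\mathcal{F})_0$. Then $\beta_M\circ\alpha_M=\mathrm{id}_{\mathfrak{F}^r(M)}$. In particular, $\alpha_M:\mathfrak{F}^r(M)\to\mathfrak{G}^r_c(M)$ is an injection, identifying the class of $C^r$-foliations on $M$ with a subclass of the class of $C^r$-diffeomorphism groups of $M$.
   Context: Weakly imbedded submanifolds: let $L\subset M$ be endowed with a $C^r$-differentiable structure making it an immersed submanifold. $L$ is weakly imbedded if for every locally connected topological space $N$ and every continuous map $f:N\to M$ with $f(N)\subset L$, the map $f:N\to L$ is continuous as well. Foliations: a foliation of class $C^r$ on $M$ ($\dim M=n$) is a partition $\mathcal{F}$ of $M$ into connected weakly imbedded submanifolds, called leaves (possibly of different dimensions), such that if $x$ belongs to a $k$-dimensional leaf, then there is a local $C^r$ chart $(U,\phi)$ of $M$ with $\phi(x)=0$ and $\phi(U)=V\times W$, where $V$ is open in $\mathbb{R}^k$ and $W$ is open in $\mathbb{R}^{n-k}$, such that for every $L\in\mathcal{F}$ one has $\phi(L\cap U)=V\times l$, where $l=\{w\in W:\phi^{-1}(0,w)\in L\}$. $\mathfrak{F}^r(M)$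 denotes the class of all foliations of class $C^r$ on $M$. Isotopies and groups: a $C^r$ isotopy is a $C^r$ map $\mathbb{R}\times M\to M$, $(t,x)\mapsto f_t(x)$, with each $f_t$ a $C^r$ diffeomorphism of $M$ and $f_0=\mathrm{id}$; it joins $f_1$ to the identity. It is compactly supported if there is a compact set outside of which all $f_t$ are the identity. It is an isotopy in a group $G$ if $f_t\in G$ for all $t$. $\mathfrak{G}^r(M)$ (resp. $\mathfrak{G}^r_c(M)$) is the class of all groups $G\leq\mathrm{Diff}^r(M)$ of $C^r$ diffeomorphisms of $M$ that are isotopically connected (resp. isotopically connected through compactly supported isotopies), i.e. every $f\in G$ can be joined to $\mathrm{id}_M$ by a $C^r$ isotopy in $G$ (resp. by a compactly supported $C^r$ isotopy in $G$). So $\mathfrak{G}^r_c(M)\subset\mathfrak{G}^r(M)$. For $G\in\mathfrak{G}^r(M)$, $\mathcal{F}_G$ is the foliation of class $C^r$ whose leaves are the accessible sets of the isotopies in $G$: the leaf through $x$ is the set of all points obtained from $x$ by finite compositions of maps $f_t$ and $f_t^{-1}$, where $(f_t)$ ranges over isotopies in $G$ and $t\in\mathbb{R}$; it equals the orbit $G(x)$. (That this is a foliation is a theorem of Stefan and Sussmann.) $\mathrm{Diff}^r(M,\mathcal{F})$ is the group of all leaf preserving $C^r$ diffeomorphisms, i.e. those $f$ with $f(L)=L$ for every leaf $L\in\mathcal{F}$, and $\mathrm{Diff}^r_c(M,\mathcal{F})_0$ is the subgroup of all elements that can be joined to the identity by a compactly supported $C^r$ isotopy in $\mathrm{Diff}^r(M,\mathcal{F})$.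 *)

theory Defs
  imports "HOL-Analysis.Analysis" "HOL-Algebra.Bij"
begin

section \<open>Maps of class $C^r$ on open subsets of a linear space\<close>

text \<open>
  The role of $\mathbb{R}^k$ is played by a linear subspace \<open>E\<close> of dimension \<open>k\<close> of a Euclidean
  space. Then all the dimensions \<open>0, \<dots>, n\<close> are available inside one type, as is needed for
  the leaves of a foliation, whose dimensions vary. In \<open>Ck_on k E U f\<close> the set \<open>U\<close> is meant to be
  relatively open in \<open>E\<close>; the derivative at a point of \<open>U\<close> is then determined on \<open>E\<close>, and its
  values outside \<open>E\<close> are not used.
\<close>

primrec Ck_on ::
  "nat \<Rightarrow> 'e::real_normed_vector set \<Rightarrow> 'e set \<Rightarrow> ('e \<Rightarrow> 'f::real_normed_vector) \<Rightarrow> bool" where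
  "Ck_on 0 E U f \<longleftrightarrow> continuous_on U f"
| "Ck_on (Suc k) E U f \<longleftrightarrow>
     (\<exists>f'. (\<forall>x\<in>U. (f has_derivative f' x) (at x within U)) \<and> (\<forall>v\<in>E. Ck_on k E U (\<lambda>x. f' x v)))"

definition Cr_on ::
  "enat \<Rightarrow> 'e::real_normed_vector set \<Rightarrow> 'e set \<Rightarrow> ('e \<Rightarrow> 'f::real_normed_vector) \<Rightarrow> bool" where
  "Cr_on r E U f \<longleftrightarrow> (\<forall>k. enat k \<le> r \<longrightarrow> Ck_on k E U f)"


section \<open>Manifolds without boundary\<close>

text \<open>
  The topology is a component of the structure because a submanifold need not carry the subspace
  topology. Charts are pairs \<open>(U, \<phi>)\<close>; the inverse of \<open>\<phi>\<close> on \<open>\<phi> ` U\<close> is \<open>inv_into U \<phi>\<close>.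
\<close>

record ('a, 'e) manifold =
  model :: "'e set"
  mtop :: "'a topology"
  atlas :: "('a set \<times> ('a \<Rightarrow> 'e)) set"

abbreviation points :: "('a, 'e, 'z) manifold_scheme \<Rightarrow> 'a set" where
  "points M \<equiv> topspace (mtop M)"

definition topological_chart ::
  "('a, 'e::euclidean_space) manifold \<Rightarrow> 'a set \<Rightarrow> ('a \<Rightarrow> 'e) \<Rightarrow> bool" where
  "topological_chart M U \<phi> \<longleftrightarrow>
     openin (mtop M) U \<and> openin (top_of_set (model M)) (\<phi> ` U) \<and>
     homeomorphic_map (subtopology (mtop M) U) (top_of_set (\<phi> ` U)) \<phi>"

definition Cr_compatible ::
  "enat \<Rightarrow> 'e::euclidean_space set \<Rightarrow> 'a set \<Rightarrow> ('a \<Rightarrow> 'e) \<Rightarrow> 'a set \<Rightarrow> ('a \<Rightarrow> 'e) \<Rightarrow> bool" where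
  "Cr_compatible r E U \<phi> V \<psi> \<longleftrightarrow>
     Cr_on r E (\<phi> ` (U \<inter> V)) (\<psi> \<circ> inv_into U \<phi>) \<and>
     Cr_on r E (\<psi> ` (U \<inter> V)) (\<phi> \<circ> inv_into V \<psi>)"

definition Cr_manifold :: "enat \<Rightarrow> ('a, 'e::euclidean_space) manifold \<Rightarrow> bool" where
  "Cr_manifold r M \<longleftrightarrow>
     subspace (model M) \<and> Hausdorff_space (mtop M) \<and>
     (\<forall>(U, \<phi>)\<in>atlas M. topological_chart M U \<phi>) \<and>
     (\<Union>(U, \<phi>)\<in>atlas M. U) = points M \<and>
     (\<forall>(U, \<phi>)\<in>atlas M. \<forall>(V, \<psi>)\<in>atlas M. Cr_compatible r (model M) U \<phi> V \<psi>)"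

definition Cr_chart ::
  "enat \<Rightarrow> ('a, 'e::euclidean_space) manifold \<Rightarrow> 'a set \<Rightarrow> ('a \<Rightarrow> 'e) \<Rightarrow> bool" where
  "Cr_chart r M U \<phi> \<longleftrightarrow>
     topological_chart M U \<phi> \<and>
     (\<forall>(V, \<psi>)\<in>atlas M. Cr_compatible r (model M) U \<phi> V \<psi>)"

definition paracompact_space :: "'a topology \<Rightarrow> bool" where
  "paracompact_space X \<longleftrightarrow>
     (\<forall>\<U>. (\<forall>U\<in>\<U>. openin X U) \<and> \<Union>\<U> = topspace X \<longrightarrow>
       (\<exists>\<V>. (\<forall>V\<in>\<V>. openin X V) \<and> \<Union>\<V> = topspace X \<and>
            (\<forall>V\<in>\<V>. \<exists>U\<in>\<U>. V \<subseteq> U) \<and> locally_finite_in X \<V>))"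

definition Cr_map ::
  "enat \<Rightarrow> ('a, 'e::euclidean_space) manifold \<Rightarrow> ('b, 'f::euclidean_space) manifold \<Rightarrow>
   ('a \<Rightarrow> 'b) \<Rightarrow> bool" where
  "Cr_map r M N f \<longleftrightarrow>
     continuous_map (mtop M) (mtop N) f \<and>
     (\<forall>(U, \<phi>)\<in>atlas M. \<forall>(V, \<psi>)\<in>atlas N.
        Cr_on r (model M) (\<phi> ` (U \<inter> f -` V)) (\<psi> \<circ> f \<circ> inv_into U \<phi>))"

definition Cr_immersion ::
  "enat \<Rightarrow> ('a, 'e::euclidean_space) manifold \<Rightarrow> ('b, 'f::euclidean_space) manifold \<Rightarrow>
   ('a \<Rightarrow> 'b) \<Rightarrow> bool" where
  "Cr_immersion r M N f \<longleftrightarrow>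
     Cr_map r M N f \<and>
     (\<forall>(U, \<phi>)\<in>atlas M. \<forall>(V, \<psi>)\<in>atlas N. \<forall>x \<in> U \<inter> f -` V.
        \<exists>D. ((\<psi> \<circ> f \<circ> inv_into U \<phi>) has_derivative D) (at (\<phi> x) within \<phi> ` (U \<inter> f -` V)) \<and>
            inj_on D (model M))"

definition real_times :: "('a, 'e::euclidean_space) manifold \<Rightarrow> (real \<times> 'a, real \<times> 'e) manifold" where
  "real_times M =
     \<lparr>model = UNIV \<times> model M,
      mtop = prod_topology euclideanreal (mtop M),
      atlas = {(UNIV \<times> U, map_prod id \<phi>) |U \<phi>. (U, \<phi>) \<in> atlas M}\<rparr>"


section \<open>Weakly imbedded submanifolds\<close>

text \<open>
  In \<open>weakly_imbedded r M N\<close> the manifold \<open>N\<close> is the subset \<open>points N\<close> of \<open>M\<close> endowed with a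
  structure of class $C^r$. The test spaces \<open>Z\<close> range over the topologies on the type of the points
  of \<open>M\<close>; the lemma \<open>weakly_imbedded_test\<close> shows that the same property then holds for locally
  connected test spaces of every type, so nothing is lost.
\<close>

definition weakly_imbedded ::
  "enat \<Rightarrow> ('a, 'e::euclidean_space) manifold \<Rightarrow> ('a, 'e) manifold \<Rightarrow> bool" where
  "weakly_imbedded r M N \<longleftrightarrow>
     Cr_manifold r N \<and> Cr_immersion r N M (\<lambda>x. x) \<and>
     (\<forall>(Z :: 'a topology) f.
        locally_connected_space Z \<and> continuous_map Z (mtop M) f \<and> f ` topspace Z \<subseteq> points N
        \<longrightarrow> continuous_map Z (mtop N) f)"

lemma weakly_imbedded_test:
  fixes Z :: "'z topology"
  assumes wi: "weakly_imbedded r M N" and lc: "locally_connected_space Z"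
    and f: "continuous_map Z (mtop M) f" "f ` topspace Z \<subseteq> points N"
  shows "continuous_map Z (mtop N) f"
proof -
  define P where "P W \<longleftrightarrow> W \<subseteq> f ` topspace Z \<and> openin Z {x \<in> topspace Z. f x \<in> W}" for W
  have "istopology P"
    unfolding istopology_def
  proof (intro conjI allI impI)
    fix S T assume "P S" "P T"
    moreover have "{x \<in> topspace Z. f x \<in> S \<inter> T} =
        {x \<in> topspace Z. f x \<in> S} \<inter> {x \<in> topspace Z. f x \<in> T}" by auto
    ultimately show "P (S \<inter> T)" by (auto simp: P_def openin_Int)
  next
    fix \<K> assume K: "\<forall>K\<in>\<K>. P K"
    have "{x \<in> topspace Z. f x \<in> \<Union>\<K>} = (\<Union>K\<in>\<K>. {x \<in> topspace Z. f x \<in> K})" by auto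
    with K show "P (\<Union>\<K>)" by (auto simp: P_def)
  qed
  then have Q: "openin (topology P) = P" by (rule topology_inverse')
  have "{x \<in> topspace Z. f x \<in> f ` topspace Z} = topspace Z" by auto
  then have PZ: "P (f ` topspace Z)" by (simp add: P_def)
  have "W \<subseteq> f ` topspace Z" if "P W" for W using that by (simp add: P_def)
  with PZ have ts: "topspace (topology P) = f ` topspace Z"
    unfolding topspace_def Q by blast
  have q: "quotient_map Z (topology P) f"
    unfolding quotient_map_def ts Q by (auto simp: P_def)
  have "locally_connected_space (topology P)"
    using locally_connected_space_quotient_map_image[OF lc q] .
  moreover have "continuous_map (topology P) (mtop M) (\<lambda>x. x)"
    using continuous_compose_quotient_map[OF q, of "mtop M" "\<lambda>x. x"] f(1) by (simp add: o_def)
  ultimately have "continuous_map (topology P) (mtop N) (\<lambda>x. x)"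
    using wi f(2) ts unfolding weakly_imbedded_def by (metis image_ident)
  from continuous_map_compose[OF quotient_imp_continuous_map[OF q] this]
  show ?thesis by (simp add: o_def)
qed


section \<open>Foliations\<close>

definition leaf_like ::
  "enat \<Rightarrow> ('a, 'e::euclidean_space) manifold \<Rightarrow> nat \<Rightarrow> 'a set \<Rightarrow> bool" where
  "leaf_like r M k L \<longleftrightarrow>
     (\<exists>N. weakly_imbedded r M N \<and> points N = L \<and> dim (model N) = k \<and> connected_space (mtop N))"

text \<open>
  With \<open>E = model M\<close> in the role of $\mathbb{R}^n$, the decomposition
  $\mathbb{R}^n = \mathbb{R}^k \times \mathbb{R}^{n-k}$ becomes the orthogonal decomposition of \<open>E\<close>
  into a \<open>k\<close>-dimensional subspace \<open>E\<^sub>1\<close> and its complement \<open>E\<^sub>2\<close> in \<open>E\<close>, and \<open>(v, w)\<close> becomes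
  \<open>v + w\<close>.
\<close>

definition distinguished_chart ::
  "enat \<Rightarrow> ('a, 'e::euclidean_space) manifold \<Rightarrow> 'a set set \<Rightarrow> nat \<Rightarrow> 'a \<Rightarrow>
   'a set \<Rightarrow> ('a \<Rightarrow> 'e) \<Rightarrow> bool" where
  "distinguished_chart r M \<F> k x U \<phi> \<longleftrightarrow>
     Cr_chart r M U \<phi> \<and> x \<in> U \<and> \<phi> x = 0 \<and>
     (\<exists>E\<^sub>1 E\<^sub>2 V W.
        subspace E\<^sub>1 \<and> E\<^sub>1 \<subseteq> model M \<and> dim E\<^sub>1 = k \<and> E\<^sub>2 = model M \<inter> orthogonal_comp E\<^sub>1 \<and>
        openin (top_of_set E\<^sub>1) V \<and> openin (top_of_set E\<^sub>2) W \<and>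
        \<phi> ` U = {v + w |v w. v \<in> V \<and> w \<in> W} \<and>
        (\<forall>L\<in>\<F>. \<phi> ` (L \<inter> U) =
           {v + l |v l. v \<in> V \<and> l \<in> {w \<in> W. inv_into U \<phi> (0 + w) \<in> L}}))"

definition foliations :: "enat \<Rightarrow> ('a, 'e::euclidean_space) manifold \<Rightarrow> 'a set set set" where
  "foliations r M =
     {\<F>. partition_on (points M) \<F> \<and>
          (\<forall>L\<in>\<F>. \<exists>k. leaf_like r M k L) \<and>
          (\<forall>L\<in>\<F>. \<forall>x\<in>L. \<forall>k. leaf_like r M k L \<longrightarrow> (\<exists>U \<phi>. distinguished_chart r M \<F> k x U \<phi>))}"


section \<open>Diffeomorphism groups and isotopies\<close>

text \<open>Diffeomorphisms are extensional functions, as in \<^const>\<open>BijGroup\<close>; thus the identity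
  is \<open>\<lambda>x\<in>points M. x\<close>.\<close>

definition Diff :: "enat \<Rightarrow> ('a, 'e::euclidean_space) manifold \<Rightarrow> ('a \<Rightarrow> 'a) set" where
  "Diff r M =
     {f \<in> Bij (points M). Cr_map r M M f \<and> Cr_map r M M (\<lambda>x\<in>points M. inv_into (points M) f x)}"

definition Diff_group :: "enat \<Rightarrow> ('a, 'e::euclidean_space) manifold \<Rightarrow> ('a \<Rightarrow> 'a) monoid" where
  "Diff_group r M = (BijGroup (points M))\<lparr>carrier := Diff r M\<rparr>"

definition isotopy ::
  "enat \<Rightarrow> ('a, 'e::euclidean_space) manifold \<Rightarrow> (real \<Rightarrow> 'a \<Rightarrow> 'a) \<Rightarrow> bool" where
  "isotopy r M f \<longleftrightarrow>
     Cr_map r (real_times M) M (\<lambda>(t, x). f t x) \<and>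
     (\<forall>t. f t \<in> Diff r M) \<and> f 0 = (\<lambda>x\<in>points M. x)"

definition compactly_supported ::
  "('a, 'e::euclidean_space) manifold \<Rightarrow> (real \<Rightarrow> 'a \<Rightarrow> 'a) \<Rightarrow> bool" where
  "compactly_supported M f \<longleftrightarrow>
     (\<exists>K. compactin (mtop M) K \<and> (\<forall>t. \<forall>x \<in> points M - K. f t x = x))"

definition isotopy_in ::
  "enat \<Rightarrow> ('a, 'e::euclidean_space) manifold \<Rightarrow> ('a \<Rightarrow> 'a) set \<Rightarrow> (real \<Rightarrow> 'a \<Rightarrow> 'a) \<Rightarrow> bool" where
  "isotopy_in r M G f \<longleftrightarrow> isotopy r M f \<and> (\<forall>t. f t \<in> G)"

definition isotopically_connected_groups ::
  "enat \<Rightarrow> ('a, 'e::euclidean_space) manifold \<Rightarrow> ('a \<Rightarrow> 'a) set set" where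
  "isotopically_connected_groups r M =
     {G. subgroup G (Diff_group r M) \<and> (\<forall>g\<in>G. \<exists>f. isotopy_in r M G f \<and> f 1 = g)}"

definition isotopically_connected_groups_c ::
  "enat \<Rightarrow> ('a, 'e::euclidean_space) manifold \<Rightarrow> ('a \<Rightarrow> 'a) set set" where
  "isotopically_connected_groups_c r M =
     {G. subgroup G (Diff_group r M) \<and>
         (\<forall>g\<in>G. \<exists>f. isotopy_in r M G f \<and> compactly_supported M f \<and> f 1 = g)}"

lemma isotopically_connected_groups_c_subset:
  "isotopically_connected_groups_c r M \<subseteq> isotopically_connected_groups r M"
  unfolding isotopically_connected_groups_c_def isotopically_connected_groups_def by blast


section \<open>Passing between groups and foliations\<close>

inductive_set accessible ::
  "enat \<Rightarrow> ('a, 'e::euclidean_space) manifold \<Rightarrow> ('a \<Rightarrow> 'a) set \<Rightarrow> 'a \<Rightarrow> 'a set"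
  for r M G x where
  start: "x \<in> accessible r M G x"
| forward: "y \<in> accessible r M G x \<Longrightarrow> isotopy_in r M G f \<Longrightarrow> f t y \<in> accessible r M G x"
| backward: "y \<in> accessible r M G x \<Longrightarrow> isotopy_in r M G f \<Longrightarrow>
    inv_into (points M) (f t) y \<in> accessible r M G x"

definition beta ::
  "enat \<Rightarrow> ('a, 'e::euclidean_space) manifold \<Rightarrow> ('a \<Rightarrow> 'a) set \<Rightarrow> 'a set set" where
  "beta r M G = accessible r M G ` points M"

definition Diff_leaf ::
  "enat \<Rightarrow> ('a, 'e::euclidean_space) manifold \<Rightarrow> 'a set set \<Rightarrow> ('a \<Rightarrow> 'a) set" where
  "Diff_leaf r M \<F> = {f \<in> Diff r M. \<forall>L\<in>\<F>. f ` L = L}"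

definition alpha ::
  "enat \<Rightarrow> ('a, 'e::euclidean_space) manifold \<Rightarrow> 'a set set \<Rightarrow> ('a \<Rightarrow> 'a) set" where
  "alpha r M \<F> =
     {g \<in> Diff_leaf r M \<F>.
        \<exists>f. isotopy_in r M (Diff_leaf r M \<F>) f \<and> compactly_supported M f \<and> f 1 = g}"

end

theory Submission
  imports Defs
begin

text \<open>
  Leaf preserving isotopies cannot leave a leaf, so the accessible sets of $G_{\mathcal{F}}$ refine
  $\mathcal{F}$. Conversely, in a distinguished chart around \<open>x\<close> the shears
  \<open>z \<mapsto> z + c(t) g(z) u\<close>, with \<open>g\<close> a bump function and \<open>u\<close> a small vector in the direction of
  the plaques, are diffeomorphisms that preserve all plaques; extended by the identity they are
  compactly supported isotopies in $G_{\mathcal{F}}$ moving \<open>x\<close> to every nearby point of its plaque.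
  The plaque is open in the leaf, by weak imbeddedness and invariance of domain, so the accessible
  sets are open in the leaf topology, and a leaf, being connected, is a single accessible set.
  The group $G_{\mathcal{F}}$ is closed under inverses because $f_1^{-1} \circ f_{1-t}$ joins the
  identity to $f_1^{-1}$.
\<close>

section \<open>Calculus of maps of class $C^r$\<close>

text \<open>Plaques could be swept out by flows of cut-off vector fields. Shears do the same by an
  explicit formula: \<open>z + g z *\<^sub>R u\<close> is the identity plus a map with Lipschitz
  constant \<open>B * norm u\<close>, and once this is below 1 the contraction principle gives
  bijectivity. A diffeomorphism needs a C^r inverse only for each single time, so joint dependence
  on time and point is verified for the shears but not for their inverses. For the same reason
  inverses in the group are reached through the fixed inverse of f_1 and not through the inverses of
  f_t. Distinguished charts need not belong to the atlas, and an extension by the identity follows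
  different formulas on different open sets; hence C^r maps are characterized through arbitrary
  compatible charts near each point. A distinguished chart describes the trace of a leaf only as a
  union of plaques, which may accumulate on each other in \<open>M\<close>. Openness of one plaque
  in the leaf topology therefore cannot be read off the chart and has to come from the test-space
  property.\<close>

lemma Ck_on_cong:
  "(\<And>x. x \<in> U \<Longrightarrow> f x = g x) \<Longrightarrow> Ck_on k E U f \<longleftrightarrow> Ck_on k E U g"
proof (cases k)
  case 0
  assume "\<And>x. x \<in> U \<Longrightarrow> f x = g x"
  with 0 show ?thesis by (simp cong: continuous_on_cong)
next
  case (Suc m)
  assume eq: "\<And>x. x \<in> U \<Longrightarrow> f x = g x"
  have "(f has_derivative D) (at x within U) \<longleftrightarrow> (g has_derivative D) (at x within U)"
    if "x \<in> U" for x D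
    using has_derivative_transform[OF that, of g f] has_derivative_transform[OF that, of f g] eq
    by metis
  with Suc show ?thesis by simp
qed

lemma Ck_on_mono: "Ck_on k E U f \<Longrightarrow> F \<subseteq> E \<Longrightarrow> V \<subseteq> U \<Longrightarrow> Ck_on k F V f"
proof (induction k arbitrary: f)
  case 0
  then show ?case by (auto intro: continuous_on_subset)
next
  case (Suc k)
  then obtain f' where f': "\<forall>x\<in>U. (f has_derivative f' x) (at x within U)"
    "\<forall>v\<in>E. Ck_on k E U (\<lambda>x. f' x v)" by auto
  then show ?case
    using Suc by (auto intro!: exI[of _ f'] intro: has_derivative_subset)
qed

lemma Ck_on_SucD: "Ck_on (Suc k) E U f \<Longrightarrow> Ck_on k E U f"
proof (induction k arbitrary: f)
  case 0
  then show ?case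
    by (auto simp: continuous_on_eq_continuous_within intro: has_derivative_continuous)
next
  case (Suc k)
  obtain f' where f': "\<forall>x\<in>U. (f has_derivative f' x) (at x within U)"
    "\<forall>v\<in>E. Ck_on (Suc k) E U (\<lambda>x. f' x v)" using Suc.prems by (subst (asm) Ck_on.simps(2)) auto
  then show ?case using Suc.IH by auto
qed

lemma Ck_on_continuous: "Ck_on k E U f \<Longrightarrow> continuous_on U f"
  by (induction k) (auto dest: Ck_on_SucD simp del: Ck_on.simps(2))

lemma Ck_on_const [simp]: "Ck_on k E U (\<lambda>x. c)"
  by (induction k arbitrary: c) (auto intro!: exI[of _ "\<lambda>_ _. 0"])

lemma Ck_on_bounded_linear: "bounded_linear f \<Longrightarrow> Ck_on k E U f"
  by (cases k) (auto intro!: exI[of _ "\<lambda>_. f"] linear_continuous_on bounded_linear_imp_has_derivative)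

lemma Ck_on_linear_compose:
  assumes L: "bounded_linear L"
  shows "Ck_on k E U f \<Longrightarrow> Ck_on k E U (\<lambda>x. L (f x))"
proof (induction k arbitrary: f)
  case 0
  then show ?case
    using continuous_on_compose2[OF linear_continuous_on[OF L, of UNIV]] by simp
next
  case (Suc k)
  then obtain f' where "\<forall>x\<in>U. (f has_derivative f' x) (at x within U)"
    "\<forall>v\<in>E. Ck_on k E U (\<lambda>x. f' x v)" by auto
  then show ?case
    using Suc.IH
    by (auto intro!: exI[of _ "\<lambda>x v. L (f' x v)"] bounded_linear.has_derivative[OF L])
qed

lemma Ck_on_add: "Ck_on k E U f \<Longrightarrow> Ck_on k E U g \<Longrightarrow> Ck_on k E U (\<lambda>x. f x + g x)"
proof (induction k arbitrary: f g)
  case 0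
  then show ?case by (auto intro: continuous_on_add)
next
  case (Suc k)
  then obtain f' g' where "\<forall>x\<in>U. (f has_derivative f' x) (at x within U)"
    "\<forall>v\<in>E. Ck_on k E U (\<lambda>x. f' x v)"  "\<forall>x\<in>U. (g has_derivative g' x) (at x within U)"
    "\<forall>v\<in>E. Ck_on k E U (\<lambda>x. g' x v)" by auto
  then show ?case
    using Suc.IH by (auto intro!: exI[of _ "\<lambda>x v. f' x v + g' x v"] has_derivative_add)
qed

lemma Ck_on_sum:
  "(\<And>b. b \<in> B \<Longrightarrow> Ck_on k E U (f b)) \<Longrightarrow> Ck_on k E U (\<lambda>x. \<Sum>b\<in>B. f b x)"
  by (induction B rule: infinite_finite_induct) (auto intro: Ck_on_add)

text \<open>By the Leibniz rule the derivative is a sum of two terms of the same shape, each pairing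
  a derivative with an undifferentiated factor, and the latter is of class C^k by
  \<open>Ck_on_SucD\<close>. A general \<open>B\<close> covers scaling, products and inner products
  at once.\<close>

lemma Ck_on_bilinear:
  assumes B: "bounded_bilinear B"
  shows "Ck_on k E U f \<Longrightarrow> Ck_on k E U g \<Longrightarrow> Ck_on k E U (\<lambda>x. B (f x) (g x))"
proof (induction k arbitrary: f g)
  case 0
  then show ?case by (auto intro: bounded_bilinear.continuous_on[OF B])
next
  case (Suc k)
  then obtain f' g' where "\<forall>x\<in>U. (f has_derivative f' x) (at x within U)"
    "\<forall>v\<in>E. Ck_on k E U (\<lambda>x. f' x v)"  "\<forall>x\<in>U. (g has_derivative g' x) (at x within U)"
    "\<forall>v\<in>E. Ck_on k E U (\<lambda>x. g' x v)" by auto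
  moreover have "Ck_on k E U f" "Ck_on k E U g" using Suc.prems by (blast dest: Ck_on_SucD)+
  ultimately show ?case
    using Suc.IH
    by (auto intro!: exI[of _ "\<lambda>x v. B (f x) (g' x v) + B (f' x v) (g x)"] Ck_on_add
        bounded_bilinear.FDERIV[OF B])
qed

lemmas Ck_on_scaleR = Ck_on_bilinear[OF bounded_bilinear_scaleR]
lemmas Ck_on_mult = Ck_on_bilinear[OF bounded_bilinear_mult]
lemmas Ck_on_inner = Ck_on_bilinear[OF bounded_bilinear_inner]

lemma Ck_on_Pair:
  assumes "Ck_on k E U f" "Ck_on k E U g"
  shows "Ck_on k E U (\<lambda>x. (f x, g x))"
proof -
  have "Ck_on k E U (\<lambda>x. (f x, 0) + (0, g x))"
    by (intro Ck_on_add Ck_on_linear_compose[where L = "\<lambda>y. (y, 0)"]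
        Ck_on_linear_compose[where L = "\<lambda>y. (0, y)"] assms bounded_linear_Pair
        bounded_linear_ident bounded_linear_zero)
  then show ?thesis by simp
qed

text \<open>The derivative contains \<open>inverse (f x)\<close> again, now only required to be of
  class C^k: this is the induction hypothesis.\<close>

lemma Ck_on_inverse:
  fixes f :: "'e::real_normed_vector \<Rightarrow> real"
  assumes "\<And>x. x \<in> U \<Longrightarrow> f x \<noteq> 0"
  shows "Ck_on k E U f \<Longrightarrow> Ck_on k E U (\<lambda>x. inverse (f x))"
proof (induction k)
  case 0
  then show ?case using assms by (auto intro: continuous_on_inverse)
next
  case (Suc k)
  then obtain f' where f': "\<forall>x\<in>U. (f has_derivative f' x) (at x within U)"
    "\<forall>v\<in>E. Ck_on k E U (\<lambda>x. f' x v)" by auto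
  have "Ck_on k E U (\<lambda>x. inverse (f x))" using Suc by (blast dest: Ck_on_SucD)
  then have "Ck_on k E U (\<lambda>x. - 1 * (inverse (f x) * f' x v * inverse (f x)))" if "v \<in> E" for v
    by (intro Ck_on_mult Ck_on_const) (use f' that in auto)
  with f'(1) assms show ?case
    by (auto intro!: exI[of _ "\<lambda>x v. - (inverse (f x) * f' x v * inverse (f x))"] has_derivative_inverse)
qed

text \<open>The derivative witnessing \<^const>\<open>Ck_on\<close> is arbitrary outside \<open>E\<close>; directional derivatives
  along \<open>E\<close> are canonical, which allows local witnesses to be patched.\<close>

definition dirder :: "('e::real_normed_vector \<Rightarrow> 'f::real_normed_vector) \<Rightarrow> 'e \<Rightarrow> 'e \<Rightarrow> 'f" where
  "dirder f x v = vector_derivative (\<lambda>t. f (x + t *\<^sub>R v)) (at 0)"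

text \<open>Since \<open>U\<close> is relatively open in \<open>E\<close>, the line through
  \<open>x\<close> in direction \<open>v\<close> stays in \<open>U\<close> for small times. Along it
  the derivative within \<open>U\<close> becomes an ordinary derivative in one real variable, and
  that one is unique.\<close>

lemma has_derivative_dirder:
  assumes E: "subspace E" "openin (top_of_set E) U" and x: "x \<in> U" "v \<in> E"
    and f: "(f has_derivative f') (at x within U)"
  shows "f' v = dirder f x v"
proof -
  define \<gamma> where "\<gamma> t = x + t *\<^sub>R v" for t :: real
  obtain S where S: "open S" "U = E \<inter> S" using E(2) by (auto simp: openin_open)
  have \<gamma>E: "\<gamma> t \<in> E" for t
    using E(1) x S by (auto simp: \<gamma>_def subspace_add subspace_scale)
  define T where "T = \<gamma> -` S"
  have "open T" unfolding T_def
    by (rule open_vimage[OF S(1)]) (auto simp: \<gamma>_def intro!: continuous_intros)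
  have T0: "0 \<in> T" using x S by (auto simp: T_def \<gamma>_def)
  have sub: "\<gamma> ` T \<subseteq> U" using \<gamma>E S by (auto simp: T_def)
  have d\<gamma>: "(\<gamma> has_derivative (\<lambda>t. t *\<^sub>R v)) (at 0 within T)"
    unfolding \<gamma>_def by (auto intro!: derivative_eq_intros)
  have "(f has_derivative f') (at (\<gamma> 0) within \<gamma> ` T)"
    using has_derivative_subset[OF f sub] by (simp add: \<gamma>_def)
  from diff_chain_within[OF d\<gamma> this]
  have "(f \<circ> \<gamma> has_derivative f' \<circ> (\<lambda>t. t *\<^sub>R v)) (at 0)"
    using at_within_open[OF T0 \<open>open T\<close>] by simp
  then have "((\<lambda>t. f (x + t *\<^sub>R v)) has_vector_derivative f' v) (at 0)"
    using linear_scale[OF has_derivative_linear[OF f]]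
    by (simp add: has_vector_derivative_def o_def \<gamma>_def)
  then show ?thesis by (simp add: dirder_def vector_derivative_at)
qed

text \<open>Trades the existential witness for \<open>dirder f\<close>, an expression in which
  \<open>U\<close> does not occur, so that different relatively open sets can be compared at common
  points.\<close>

lemma Ck_on_Suc_iff:
  assumes "subspace E" "openin (top_of_set E) U"
  shows "Ck_on (Suc k) E U f \<longleftrightarrow>
    (\<forall>x\<in>U. f differentiable (at x within U)) \<and> (\<forall>v\<in>E. Ck_on k E U (\<lambda>x. dirder f x v))"
    (is "?L \<longleftrightarrow> ?R")
proof
  assume ?L
  then obtain f' where f': "\<forall>x\<in>U. (f has_derivative f' x) (at x within U)"
    "\<forall>v\<in>E. Ck_on k E U (\<lambda>x. f' x v)" by auto
  have "Ck_on k E U (\<lambda>x. f' x v) \<longleftrightarrow> Ck_on k E U (\<lambda>x. dirder f x v)" if "v \<in> E" for v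
    by (rule Ck_on_cong) (use f' that has_derivative_dirder[OF assms] in blast)
  with f' show ?R by (auto simp: differentiable_def)
next
  assume R: ?R
  then obtain f' where f': "\<forall>x\<in>U. (f has_derivative f' x) (at x within U)"
    unfolding differentiable_def by metis
  have "Ck_on k E U (\<lambda>x. f' x v) \<longleftrightarrow> Ck_on k E U (\<lambda>x. dirder f x v)" if "v \<in> E" for v
    by (rule Ck_on_cong) (use f' that has_derivative_dirder[OF assms] in blast)
  with f' R show ?L by auto
qed

lemma at_within_openin:
  assumes "openin (top_of_set U) T" "x \<in> T"
  shows "at x within T = at x within U"
proof -
  obtain S where "open S" "T = U \<inter> S" using assms(1) by (auto simp: openin_open)
  with assms(2) show ?thesis by (auto intro: at_within_nhd[of x S])
qed

text \<open>\<open>U\<close> and every piece \<open>T\<close> are open in \<open>E\<close>, so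
  \<open>Ck_on_Suc_iff\<close> refers on all of them to one and the same \<open>dirder f\<close>.
  The induction, with \<open>f\<close> generalized, passes to that function.\<close>

lemma Ck_on_local:
  assumes E: "subspace E" "openin (top_of_set E) U"
    and loc: "\<And>x. x \<in> U \<Longrightarrow> \<exists>T. openin (top_of_set U) T \<and> x \<in> T \<and> Ck_on k E T f"
  shows "Ck_on k E U f"
  using loc
proof (induction k arbitrary: f)
  case 0
  have "continuous (at x within U) f" if x: "x \<in> U" for x
  proof -
    obtain T where T: "openin (top_of_set U) T" "x \<in> T" "Ck_on 0 E T f"
      using 0[OF x] by blast
    then show ?thesis
      using at_within_openin[OF T(1,2)] by (auto simp: continuous_on_eq_continuous_within)
  qed
  then show ?case by (simp add: continuous_on_eq_continuous_within)
next
  case (Suc k)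
  have "f differentiable (at x within U)" if x: "x \<in> U" for x
  proof -
    obtain T where T: "openin (top_of_set U) T" "x \<in> T" "Ck_on (Suc k) E T f"
      using Suc.prems[OF x] by blast
    then have "f differentiable (at x within T)" by (auto simp: differentiable_def)
    then show ?thesis using at_within_openin[OF T(1,2)] by simp
  qed
  moreover have "Ck_on k E U (\<lambda>x. dirder f x v)" if "v \<in> E" for v
  proof (rule Suc.IH)
    fix x assume "x \<in> U"
    then obtain T where T: "openin (top_of_set U) T" "x \<in> T" "Ck_on (Suc k) E T f"
      using Suc.prems by blast
    then have "openin (top_of_set E) T" using E(2) openin_trans by blast
    with T that show "\<exists>T. openin (top_of_set U) T \<and> x \<in> T \<and> Ck_on k E T (\<lambda>x. dirder f x v)"
      unfolding Ck_on_Suc_iff[OF E(1) \<open>openin (top_of_set E) T\<close>] by blast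
  qed
  ultimately show ?case unfolding Ck_on_Suc_iff[OF E] by blast
qed

text \<open>\<^const>\<open>Ck_on\<close> only controls \<open>\<lambda>x. g' x b\<close> for fixed \<open>b\<close>, so \<open>g' (f x) (f' x v)\<close> is expanded
  in an orthonormal basis of \<open>F\<close>.\<close>

lemma Ck_on_compose:
  fixes f :: "'e::real_normed_vector \<Rightarrow> 'f::euclidean_space"
  assumes E: "subspace E" "openin (top_of_set E) U" and F: "subspace F" "f ` U \<subseteq> S" "S \<subseteq> F"
  shows "Ck_on k E U f \<Longrightarrow> Ck_on k F S g \<Longrightarrow> Ck_on k E U (\<lambda>x. g (f x))"
proof (induction k arbitrary: g)
  case 0
  then show ?case using F by (auto intro: continuous_on_compose2)
next
  case (Suc k)
  obtain f' where f': "\<forall>x\<in>U. (f has_derivative f' x) (at x within U)"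
    "\<forall>v\<in>E. Ck_on k E U (\<lambda>x. f' x v)" using Suc.prems(1) by auto
  obtain g' where g': "\<forall>x\<in>S. (g has_derivative g' x) (at x within S)"
    "\<forall>v\<in>F. Ck_on k F S (\<lambda>x. g' x v)" using Suc.prems(2) by auto
  have fk: "Ck_on k E U f" using Suc.prems(1) by (rule Ck_on_SucD)
  obtain B where B: "B \<subseteq> F" "pairwise orthogonal B" "\<And>x. x \<in> B \<Longrightarrow> norm x = 1"
    "independent B" "card B = dim F" "span B = F"
    using orthonormal_basis_subspace[OF F(1)] by blast
  \<comment> \<open>The witness \<open>g'\<close> is controlled only along \<open>F\<close>, so
    \<open>f' x v\<close> must be shown to lie there. Every \<open>y\<close> orthogonal to
    \<open>F\<close> annihilates \<open>f\<close> on \<open>U\<close>, hence also its derivative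
    along \<open>E\<close>; and \<open>F\<close> is its own double orthogonal complement.\<close>
  have inF: "f' x v \<in> F" if "x \<in> U" "v \<in> E" for x v
  proof -
    have "y \<bullet> f' x v = 0" if y: "y \<in> orthogonal_comp F" for y
    proof -
      have "((\<lambda>x. y \<bullet> f x) has_derivative (\<lambda>v. y \<bullet> f' x v)) (at x within U)"
        using f' \<open>x \<in> U\<close> by (auto intro!: derivative_intros)
      moreover have "((\<lambda>x. y \<bullet> f x) has_derivative (\<lambda>v. 0)) (at x within U)"
      proof (rule has_derivative_transform[OF \<open>x \<in> U\<close>])
        show "y \<bullet> f z = 0" if "z \<in> U" for z
          using y F that by (fastforce simp: orthogonal_comp_def orthogonal_def inner_commute)
      qed simp
      ultimately show ?thesis
        by (metis (no_types) has_derivative_dirder[OF E \<open>x \<in> U\<close> \<open>v \<in> E\<close>])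
    qed
    then have "f' x v \<in> orthogonal_comp (orthogonal_comp F)"
      by (auto simp: orthogonal_comp_def orthogonal_def)
    then show ?thesis using orthogonal_comp_self[OF F(1)] by simp
  qed
  have expand: "(\<Sum>b\<in>B. (f' x v \<bullet> b) *\<^sub>R g' (f x) b) = g' (f x) (f' x v)"
    if "x \<in> U" "v \<in> E" for x v
  proof -
    have "linear (g' (f x))" using g'(1) F that by (auto intro: has_derivative_linear)
    have ex: "(\<Sum>b\<in>B. (f' x v \<bullet> b) *\<^sub>R b) = f' x v"
    proof -
      \<comment> \<open>The residue of the Gram-Schmidt projection lies in the span of
        \<open>B\<close> and is orthogonal to it, hence is 0. The vectors of \<open>B\<close> have
        norm 1, so the denominators drop out.\<close>
      define d where "d = f' x v - (\<Sum>b\<in>B. (b \<bullet> f' x v / (b \<bullet> b)) *\<^sub>R b)"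
      have orth: "orthogonal d y" if "y \<in> span B" for y
        using Gram_Schmidt_step[OF B(2) that, of "f' x v"] unfolding d_def
        by (subst orthogonal_commute)
      have "f' x v \<in> span B" using inF[OF that] B by simp
      then have "d \<in> span B"
        unfolding d_def by (intro span_diff span_sum span_scale) (auto intro: span_base)
      then have "d = 0" using orth orthogonal_self by blast
      moreover have "(\<Sum>b\<in>B. (b \<bullet> f' x v / (b \<bullet> b)) *\<^sub>R b) = (\<Sum>b\<in>B. (f' x v \<bullet> b) *\<^sub>R b)"
        by (intro sum.cong) (auto simp: B(3) dot_square_norm inner_commute)
      ultimately show ?thesis by (simp add: d_def)
    qed
    have "g' (f x) (\<Sum>b\<in>B. (f' x v \<bullet> b) *\<^sub>R b) = (\<Sum>b\<in>B. (f' x v \<bullet> b) *\<^sub>R g' (f x) b)"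
      using \<open>linear (g' (f x))\<close> by (simp add: linear_sum linear_scale)
    with ex show ?thesis by simp
  qed
  have "Ck_on k E U (\<lambda>x. g' (f x) (f' x v))" if v: "v \<in> E" for v
  proof -
    have "Ck_on k E U (\<lambda>x. \<Sum>b\<in>B. (f' x v \<bullet> b) *\<^sub>R g' (f x) b)"
      by (intro Ck_on_sum Ck_on_scaleR Ck_on_inner Ck_on_const Suc.IH[OF fk])
        (use v f' g' B in auto)
    also have "?this \<longleftrightarrow> ?thesis" by (rule Ck_on_cong) (rule expand[OF _ v])
    finally show ?thesis .
  qed
  moreover have "((\<lambda>x. g (f x)) has_derivative (\<lambda>v. g' (f x) (f' x v))) (at x within U)"
    if "x \<in> U" for x
  proof -
    have "(g has_derivative g' (f x)) (at (f x) within f ` U)"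
      using has_derivative_subset[OF _ F(2)] g'(1) F(2) that by blast
    from diff_chain_within[OF f'(1)[rule_format, OF that] this] show ?thesis by (simp add: o_def)
  qed
  ultimately show ?case
    unfolding Ck_on.simps by (intro exI[of _ "\<lambda>x v. g' (f x) (f' x v)"]) blast
qed

section \<open>Class C^r for finite and infinite r\<close>

lemma Cr_on_cong: "(\<And>x. x \<in> U \<Longrightarrow> f x = g x) \<Longrightarrow> Cr_on r E U f \<longleftrightarrow> Cr_on r E U g"
  unfolding Cr_on_def using Ck_on_cong by blast

lemma Cr_on_mono: "Cr_on r E U f \<Longrightarrow> F \<subseteq> E \<Longrightarrow> V \<subseteq> U \<Longrightarrow> Cr_on r F V f"
  unfolding Cr_on_def using Ck_on_mono by blast

lemma Cr_on_le: "Cr_on s E U f \<Longrightarrow> r \<le> s \<Longrightarrow> Cr_on r E U f"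
  unfolding Cr_on_def using order_trans by blast

lemma Cr_on_continuous: "Cr_on r E U f \<Longrightarrow> continuous_on U f"
  unfolding Cr_on_def by (metis Ck_on_continuous zero_enat_def zero_le)

lemma Cr_on_local:
  assumes "subspace E" "openin (top_of_set E) U"
    and "\<And>x. x \<in> U \<Longrightarrow> \<exists>T. openin (top_of_set U) T \<and> x \<in> T \<and> Cr_on r E T f"
  shows "Cr_on r E U f"
  unfolding Cr_on_def
  by (intro allI impI Ck_on_local[OF assms(1,2)]) (use assms(3) in \<open>unfold Cr_on_def, blast\<close>)

lemma Cr_on_compose:
  fixes f :: "'e::real_normed_vector \<Rightarrow> 'f::euclidean_space"
  assumes "subspace E" "openin (top_of_set E) U" "subspace F" "f ` U \<subseteq> S" "S \<subseteq> F"
    "Cr_on r E U f" "Cr_on r F S g"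
  shows "Cr_on r E U (\<lambda>x. g (f x))"
  using assms unfolding Cr_on_def by (blast intro: Ck_on_compose)

section \<open>Charts and maps of class $C^r$\<close>

lemma Cr_compatible_le:
  "Cr_compatible s E U \<phi> V \<psi> \<Longrightarrow> r \<le> s \<Longrightarrow> Cr_compatible r E U \<phi> V \<psi>"
  unfolding Cr_compatible_def using Cr_on_le by blast

text \<open>Lets the smooth manifold of the theorem be treated as one of class C^r, so that a single
  regularity class is used throughout.\<close>

lemma Cr_manifold_le:
  assumes "Cr_manifold s M" "r \<le> s"
  shows "Cr_manifold r M"
proof -
  have "\<forall>x\<in>atlas M. \<forall>y\<in>atlas M. Cr_compatible s (model M) (fst x) (snd x) (fst y) (snd y)"
    using assms(1) by (simp add: Cr_manifold_def case_prod_beta)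
  then have "\<forall>x\<in>atlas M. \<forall>y\<in>atlas M. Cr_compatible r (model M) (fst x) (snd x) (fst y) (snd y)"
    using Cr_compatible_le[OF _ assms(2)] by metis
  with assms(1) show ?thesis by (simp add: Cr_manifold_def case_prod_beta)
qed

lemma Cr_manifold_subspace: "Cr_manifold r M \<Longrightarrow> subspace (model M)"
  by (simp add: Cr_manifold_def)

lemma atlas_Cr_chart: "Cr_manifold r M \<Longrightarrow> (U, \<phi>) \<in> atlas M \<Longrightarrow> Cr_chart r M U \<phi>"
  by (auto simp: Cr_manifold_def Cr_chart_def)

lemma atlas_chart_at:
  assumes "Cr_manifold r M" "x \<in> points M"
  obtains U \<phi> where "(U, \<phi>) \<in> atlas M" "x \<in> U"
proof -
  have "x \<in> (\<Union>(U, \<phi>)\<in>atlas M. U)" using assms by (simp add: Cr_manifold_def)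
  then show ?thesis using that by auto
qed

lemma Cr_chart_compatible:
  "Cr_chart r M U \<phi> \<Longrightarrow> (V, \<psi>) \<in> atlas M \<Longrightarrow> Cr_compatible r (model M) U \<phi> V \<psi>"
  by (auto simp: Cr_chart_def)

lemma Cr_chart_topological: "Cr_chart r M U \<phi> \<Longrightarrow> topological_chart M U \<phi>"
  by (simp add: Cr_chart_def)

section \<open>Topology of a single chart\<close>

context
  fixes M :: "('a, 'e::euclidean_space) manifold" and U \<phi>
  assumes chart: "topological_chart M U \<phi>"
begin

lemma chart_open: "openin (mtop M) U"
  using chart by (simp add: topological_chart_def)

lemma chart_subset: "U \<subseteq> points M"
  using chart_open by (rule openin_subset)

lemma chart_inj: "inj_on \<phi> U"
proof -
  have "topspace (subtopology (mtop M) U) = U" using chart_subset by auto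
  with chart show ?thesis
    unfolding topological_chart_def by (metis homeomorphic_imp_injective_map)
qed

lemma chart_image_open:
  assumes "openin (mtop M) \<Omega>" "\<Omega> \<subseteq> U"
  shows "openin (top_of_set (model M)) (\<phi> ` \<Omega>)"
proof -
  have "openin (subtopology (mtop M) U) \<Omega>"
    using assms chart_open by (simp add: openin_open_subtopology)
  moreover have "open_map (subtopology (mtop M) U) (top_of_set (\<phi> ` U)) \<phi>"
    using chart homeomorphic_imp_open_map by (auto simp: topological_chart_def)
  ultimately have "openin (top_of_set (\<phi> ` U)) (\<phi> ` \<Omega>)" by (simp add: open_map_def)
  with chart show ?thesis unfolding topological_chart_def by (blast intro: openin_trans)
qed

lemma chart_image_subset: "\<phi> ` U \<subseteq> model M"
  using chart_image_open[OF chart_open] openin_imp_subset by blast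

lemma chart_vimage_open:
  assumes "openin (top_of_set (\<phi> ` U)) S"
  shows "openin (mtop M) {x \<in> U. \<phi> x \<in> S}"
proof -
  have "continuous_map (subtopology (mtop M) U) (top_of_set (\<phi> ` U)) \<phi>"
    using chart homeomorphic_imp_continuous_map by (auto simp: topological_chart_def)
  then have "openin (subtopology (mtop M) U) {x \<in> topspace (subtopology (mtop M) U). \<phi> x \<in> S}"
    using assms by (rule openin_continuous_map_preimage)
  moreover have "{x \<in> topspace (subtopology (mtop M) U). \<phi> x \<in> S} = {x \<in> U. \<phi> x \<in> S}"
    using chart_subset by auto
  ultimately show ?thesis using chart_open by (simp add: openin_open_subtopology)
qed

lemma chart_inv_continuous: "continuous_map (top_of_set (\<phi> ` U)) (mtop M) (inv_into U \<phi>)"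
  unfolding continuous_map_def
proof (intro conjI allI impI)
  show "inv_into U \<phi> \<in> topspace (top_of_set (\<phi> ` U)) \<rightarrow> points M"
  proof
    fix y assume "y \<in> topspace (top_of_set (\<phi> ` U))"
    then have "inv_into U \<phi> y \<in> U" by (intro inv_into_into) simp
    then show "inv_into U \<phi> y \<in> points M" using chart_subset by blast
  qed
next
  fix W assume "openin (mtop M) W"
  then have "openin (mtop M) (U \<inter> W)" using chart_open by blast
  then have "openin (top_of_set (model M)) (\<phi> ` (U \<inter> W))" by (rule chart_image_open) auto
  then have "openin (top_of_set (\<phi> ` U)) (\<phi> ` (U \<inter> W))"
    by (rule openin_subset_trans) (use chart_image_subset in auto)
  moreover have "{x \<in> topspace (top_of_set (\<phi> ` U)). inv_into U \<phi> x \<in> W} = \<phi> ` (U \<inter> W)"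
    by (auto simp: inv_into_f_f[OF chart_inj])
  ultimately show "openin (top_of_set (\<phi> ` U)) {x \<in> topspace (top_of_set (\<phi> ` U)). inv_into U \<phi> x \<in> W}"
    by simp
qed

end

text \<open>\<open>Cr_chart\<close> only promises compatibility with the atlas. Near each point the
  transition factors through an atlas chart \<open>W\<close> around that point, and being of class
  C^r is local.\<close>

lemma Cr_chart_transition:
  assumes M: "Cr_manifold r M" and U: "Cr_chart r M U \<phi>" and V: "Cr_chart r M V \<psi>"
  shows "Cr_on r (model M) (\<phi> ` (U \<inter> V)) (\<psi> \<circ> inv_into U \<phi>)"
proof (rule Cr_on_local)
  note tU = Cr_chart_topological[OF U] and tV = Cr_chart_topological[OF V]
  show E: "subspace (model M)" using M by (rule Cr_manifold_subspace)
  show UV: "openin (top_of_set (model M)) (\<phi> ` (U \<inter> V))"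
    by (rule chart_image_open[OF tU]) (use chart_open[OF tU] chart_open[OF tV] in auto)
  fix y assume "y \<in> \<phi> ` (U \<inter> V)"
  then obtain p where p: "y = \<phi> p" "p \<in> U" "p \<in> V" by blast
  then obtain W \<theta> where W: "(W, \<theta>) \<in> atlas M" "p \<in> W"
    using atlas_chart_at[OF M] chart_subset[OF tU] by blast
  have tW: "topological_chart M W \<theta>" using W M atlas_Cr_chart Cr_chart_topological by blast
  have opn: "openin (mtop M) (U \<inter> V \<inter> W)"
    using chart_open[OF tU] chart_open[OF tV] chart_open[OF tW] by blast
  have opE: "openin (top_of_set (model M)) (\<phi> ` (U \<inter> V \<inter> W))"
    by (rule chart_image_open[OF tU opn]) auto
  have inv: "inv_into U \<phi> (\<phi> x) = x" if "x \<in> U" for x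
    using chart_inj[OF tU] that by simp
  have inv': "inv_into W \<theta> (\<theta> x) = x" if "x \<in> W" for x
    using chart_inj[OF tW] that by simp
  have 1: "Cr_on r (model M) (\<phi> ` (U \<inter> V \<inter> W)) (\<theta> \<circ> inv_into U \<phi>)"
    using Cr_chart_compatible[OF U W(1)] unfolding Cr_compatible_def
    by (blast intro: Cr_on_mono)
  have 2: "Cr_on r (model M) (\<theta> ` (U \<inter> V \<inter> W)) (\<psi> \<circ> inv_into W \<theta>)"
    using Cr_chart_compatible[OF V W(1)] unfolding Cr_compatible_def
    by (blast intro: Cr_on_mono)
  have "Cr_on r (model M) (\<phi> ` (U \<inter> V \<inter> W))
      (\<lambda>y. (\<psi> \<circ> inv_into W \<theta>) ((\<theta> \<circ> inv_into U \<phi>) y))"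
    by (rule Cr_on_compose[OF E opE E _ _ 1 2])
      (use chart_image_subset[OF tW] in \<open>auto simp: inv\<close>)
  also have "?this \<longleftrightarrow> Cr_on r (model M) (\<phi> ` (U \<inter> V \<inter> W)) (\<psi> \<circ> inv_into U \<phi>)"
    by (rule Cr_on_cong) (auto simp: inv inv')
  finally have "Cr_on r (model M) (\<phi> ` (U \<inter> V \<inter> W)) (\<psi> \<circ> inv_into U \<phi>)" .
  moreover have "openin (top_of_set (\<phi> ` (U \<inter> V))) (\<phi> ` (U \<inter> V \<inter> W))"
    by (rule openin_subset_trans[OF opE]) (use openin_imp_subset[OF UV] in auto)
  ultimately show "\<exists>T. openin (top_of_set (\<phi> ` (U \<inter> V))) T \<and> y \<in> T \<and>
      Cr_on r (model M) T (\<psi> \<circ> inv_into U \<phi>)"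
    using p W by blast
qed

text \<open>The new representative is the old one preceded by the transition from
  \<open>\<phi>'\<close> to \<open>\<phi>\<close> and followed by the one from \<open>\<psi>\<close>
  to \<open>\<psi>'\<close>. Working on an open \<open>\<Omega>\<close> inside both domains makes
  these compositions meaningful.\<close>

lemma Cr_on_change_charts:
  assumes M: "Cr_manifold r M" and N: "Cr_manifold r N"
    and U: "Cr_chart r M U \<phi>" "Cr_chart r M U' \<phi>'" and V: "Cr_chart r N V \<psi>" "Cr_chart r N V' \<psi>'"
    and \<Omega>: "openin (mtop M) \<Omega>" "\<Omega> \<subseteq> U" "\<Omega> \<subseteq> U'" "f ` \<Omega> \<subseteq> V" "f ` \<Omega> \<subseteq> V'"
    and f: "Cr_on r (model M) (\<phi> ` \<Omega>) (\<psi> \<circ> f \<circ> inv_into U \<phi>)"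
  shows "Cr_on r (model M) (\<phi>' ` \<Omega>) (\<psi>' \<circ> f \<circ> inv_into U' \<phi>')"
proof -
  note t = U[THEN Cr_chart_topological] V[THEN Cr_chart_topological]
  note E = Cr_manifold_subspace[OF M] Cr_manifold_subspace[OF N]
  have o: "openin (top_of_set (model M)) (\<phi> ` \<Omega>)" "openin (top_of_set (model M)) (\<phi>' ` \<Omega>)"
    using chart_image_open[OF t(1) \<Omega>(1,2)] chart_image_open[OF t(2) \<Omega>(1,3)] .
  have inv: "\<And>x. x \<in> \<Omega> \<Longrightarrow> inv_into U \<phi> (\<phi> x) = x" "\<And>x. x \<in> \<Omega> \<Longrightarrow> inv_into U' \<phi>' (\<phi>' x) = x"
      "\<And>x. x \<in> \<Omega> \<Longrightarrow> inv_into V \<psi> (\<psi> (f x)) = f x"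
    using chart_inj[OF t(1)] chart_inj[OF t(2)] chart_inj[OF t(3)] \<Omega> by (auto intro!: inv_into_f_f)
  have 1: "Cr_on r (model M) (\<phi>' ` \<Omega>) (\<phi> \<circ> inv_into U' \<phi>')"
    by (rule Cr_on_mono[OF Cr_chart_transition[OF M U(2,1)]]) (use \<Omega> in auto)
  have 2: "Cr_on r (model N) (\<psi> ` f ` \<Omega>) (\<psi>' \<circ> inv_into V \<psi>)"
    by (rule Cr_on_mono[OF Cr_chart_transition[OF N V]]) (use \<Omega> in blast)+
  have 3: "Cr_on r (model M) (\<phi>' ` \<Omega>) (\<lambda>y. (\<psi> \<circ> f \<circ> inv_into U \<phi>) ((\<phi> \<circ> inv_into U' \<phi>') y))"
    by (rule Cr_on_compose[OF E(1) o(2) E(1) _ _ 1 f])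
      (use chart_image_subset[OF t(1)] \<Omega> in \<open>auto simp: inv\<close>)
  have "Cr_on r (model M) (\<phi>' ` \<Omega>)
      (\<lambda>y. (\<psi>' \<circ> inv_into V \<psi>) ((\<psi> \<circ> f \<circ> inv_into U \<phi>) ((\<phi> \<circ> inv_into U' \<phi>') y)))"
    by (rule Cr_on_compose[OF E(1) o(2) E(2) _ _ 3 2])
      (use chart_image_subset[OF t(3)] \<Omega> in \<open>auto simp: inv image_subset_iff\<close>)
  also have "?this \<longleftrightarrow> ?thesis"
    by (rule Cr_on_cong) (auto simp: inv)
  finally show ?thesis .
qed

text \<open>\<open>Cr_map\<close> speaks of all pairs of atlas charts. Here a single pair near
  \<open>x\<close> suffices, and it may be any compatible pair, such as distinguished charts outside
  the atlas.\<close>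

definition Cr_near ::
  "enat \<Rightarrow> ('a, 'e::euclidean_space) manifold \<Rightarrow> ('b, 'f::euclidean_space) manifold \<Rightarrow>
   ('a \<Rightarrow> 'b) \<Rightarrow> 'a \<Rightarrow> bool" where
  "Cr_near r M N f x \<longleftrightarrow>
     (\<exists>U \<phi> V \<psi> \<Omega>. Cr_chart r M U \<phi> \<and> Cr_chart r N V \<psi> \<and> openin (mtop M) \<Omega> \<and> x \<in> \<Omega> \<and>
        \<Omega> \<subseteq> U \<and> f ` \<Omega> \<subseteq> V \<and> Cr_on r (model M) (\<phi> ` \<Omega>) (\<psi> \<circ> f \<circ> inv_into U \<phi>))"

lemma Cr_nearI:
  assumes "Cr_chart r M U \<phi>" "Cr_chart r N V \<psi>" "openin (mtop M) \<Omega>" "x \<in> \<Omega>" "\<Omega> \<subseteq> U"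
    "f ` \<Omega> \<subseteq> V" "Cr_on r (model M) (\<phi> ` \<Omega>) (\<psi> \<circ> f \<circ> inv_into U \<phi>)"
  shows "Cr_near r M N f x"
  using assms unfolding Cr_near_def by blast

lemma Cr_mapE_near:
  assumes M: "Cr_manifold r M" and N: "Cr_manifold r N" and f: "Cr_map r M N f" and x: "x \<in> points M"
  obtains U \<phi> V \<psi> where "(U, \<phi>) \<in> atlas M" "x \<in> U" "(V, \<psi>) \<in> atlas N" "f x \<in> V"
    "openin (mtop M) (U \<inter> f -` V)"
    "Cr_on r (model M) (\<phi> ` (U \<inter> f -` V)) (\<psi> \<circ> f \<circ> inv_into U \<phi>)"
proof -
  have cont: "continuous_map (mtop M) (mtop N) f" using f by (simp add: Cr_map_def)
  then have "f x \<in> points N" using x by (auto simp: continuous_map_def)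
  then obtain V \<psi> where V: "(V, \<psi>) \<in> atlas N" "f x \<in> V" using atlas_chart_at[OF N] by blast
  obtain U \<phi> where U: "(U, \<phi>) \<in> atlas M" "x \<in> U" using atlas_chart_at[OF M x] by blast
  have tU: "topological_chart M U \<phi>" and tV: "topological_chart N V \<psi>"
    using U V M N atlas_Cr_chart Cr_chart_topological by blast+
  have "openin (mtop M) {x \<in> points M. f x \<in> V}"
    using openin_continuous_map_preimage[OF cont chart_open[OF tV]] .
  moreover have "U \<inter> f -` V = U \<inter> {x \<in> points M. f x \<in> V}" using chart_subset[OF tU] by auto
  ultimately have "openin (mtop M) (U \<inter> f -` V)" using chart_open[OF tU] by auto
  moreover have "Cr_on r (model M) (\<phi> ` (U \<inter> f -` V)) (\<psi> \<circ> f \<circ> inv_into U \<phi>)"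
    using f U V unfolding Cr_map_def by blast
  ultimately show ?thesis using U V that by blast
qed

text \<open>\<open>Cr_near\<close> does not presuppose continuity. It is recovered from continuity
  of the representative, because charts are homeomorphisms onto relatively open subsets of the
  model.\<close>

lemma Cr_near_continuous:
  assumes M: "Cr_manifold r M" and f: "\<And>x. x \<in> points M \<Longrightarrow> Cr_near r M N f x"
  shows "continuous_map (mtop M) (mtop N) f"
  unfolding continuous_map_def
proof (intro conjI allI impI)
  show "f \<in> points M \<rightarrow> points N"
    using f chart_subset Cr_chart_topological unfolding Cr_near_def by blast
next
  fix W assume W: "openin (mtop N) W"
  show "openin (mtop M) {x \<in> points M. f x \<in> W}"
  proof (subst openin_subopen, intro ballI)
    fix x assume x: "x \<in> {x \<in> points M. f x \<in> W}"
    then have "Cr_near r M N f x" using f by blast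
    then obtain U \<phi> V \<psi> \<Omega> where c: "Cr_chart r M U \<phi>" "Cr_chart r N V \<psi>" "openin (mtop M) \<Omega>" "x \<in> \<Omega>"
        "\<Omega> \<subseteq> U" "f ` \<Omega> \<subseteq> V" "Cr_on r (model M) (\<phi> ` \<Omega>) (\<psi> \<circ> f \<circ> inv_into U \<phi>)"
      unfolding Cr_near_def by blast
    define c where "c = \<psi> \<circ> f \<circ> inv_into U \<phi>"
    have tU: "topological_chart M U \<phi>" and tV: "topological_chart N V \<psi>"
      using c by (auto dest: Cr_chart_topological)
    have inv: "inv_into U \<phi> (\<phi> x) = x" if "x \<in> \<Omega>" for x
      using chart_inj[OF tU] that c by (auto intro!: inv_into_f_f)
    have cont: "continuous_on (\<phi> ` \<Omega>) c" using c unfolding c_def by (blast dest: Cr_on_continuous)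
    have "openin (mtop N) (V \<inter> W)" using W chart_open[OF tV] by blast
    then have "openin (top_of_set (model N)) (\<psi> ` (V \<inter> W))" by (rule chart_image_open[OF tV]) auto
    \<comment> \<open>The image of \<open>V \<inter> W\<close> is only relatively open; an ambient
      open \<open>S\<close> allows the preimage under \<open>c\<close> to be taken.\<close>
    then obtain S where S: "open S" "\<psi> ` (V \<inter> W) = model N \<inter> S" by (auto simp: openin_open)
    have oU: "openin (top_of_set (\<phi> ` U)) (\<phi> ` \<Omega>)"
      by (rule openin_subset_trans[OF chart_image_open[OF tU c(3,5)]])
        (use c chart_image_subset[OF tU] in auto)
    have "openin (top_of_set (\<phi> ` \<Omega>)) (\<phi> ` \<Omega> \<inter> c -` S)"
      using cont S continuous_openin_preimage_gen by blast
    then have "openin (top_of_set (\<phi> ` U)) (\<phi> ` \<Omega> \<inter> c -` S)"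
      using oU openin_trans by blast
    then have "openin (mtop M) {x \<in> U. \<phi> x \<in> \<phi> ` \<Omega> \<inter> c -` S}" by (rule chart_vimage_open[OF tU])
    moreover have "{x \<in> U. \<phi> x \<in> \<phi> ` \<Omega> \<inter> c -` S} = {x \<in> \<Omega>. f x \<in> W}"
    proof -
      have "\<phi> x \<in> \<phi> ` \<Omega> \<longleftrightarrow> x \<in> \<Omega>" if "x \<in> U" for x
        using chart_inj[OF tU] c(5) that by (auto dest: inj_onD)
      moreover have "c (\<phi> x) \<in> S \<longleftrightarrow> f x \<in> W" if "x \<in> \<Omega>" for x
      proof -
        have "c (\<phi> x) = \<psi> (f x)" "f x \<in> V" using inv[OF that] that c(6) by (auto simp: c_def)
        then have "\<psi> (f x) \<in> S \<longleftrightarrow> \<psi> (f x) \<in> \<psi> ` (V \<inter> W)"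
          using S chart_image_subset[OF tV] by auto
        also have "\<dots> \<longleftrightarrow> f x \<in> W" using \<open>f x \<in> V\<close> chart_inj[OF tV] by (auto dest: inj_onD)
        finally show ?thesis using \<open>c (\<phi> x) = \<psi> (f x)\<close> by simp
      qed
      ultimately show ?thesis using c(5) by auto
    qed
    ultimately show "\<exists>T. openin (mtop M) T \<and> x \<in> T \<and> T \<subseteq> {x \<in> points M. f x \<in> W}"
      using x c(4) openin_subset[OF c(3)] by (intro exI[of _ "{x \<in> \<Omega>. f x \<in> W}"]) auto
  qed
qed

text \<open>From right to left, a change of charts moves the chosen representative to any pair of
  atlas charts near the given point, and \<open>Cr_on_local\<close> patches the results. This is the
  gluing principle for everything defined piecewise below.\<close>

lemma Cr_map_iff_near:
  assumes M: "Cr_manifold r M" and N: "Cr_manifold r N"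
  shows "Cr_map r M N f \<longleftrightarrow> (\<forall>x\<in>points M. Cr_near r M N f x)"
proof
  assume f: "Cr_map r M N f"
  show "\<forall>x\<in>points M. Cr_near r M N f x"
  proof
    fix x assume "x \<in> points M"
    then obtain U \<phi> V \<psi> where "(U, \<phi>) \<in> atlas M" "x \<in> U" "(V, \<psi>) \<in> atlas N" "f x \<in> V"
      "openin (mtop M) (U \<inter> f -` V)"
      "Cr_on r (model M) (\<phi> ` (U \<inter> f -` V)) (\<psi> \<circ> f \<circ> inv_into U \<phi>)"
      by (rule Cr_mapE_near[OF M N f])
    then show "Cr_near r M N f x"
      by (intro Cr_nearI[of r M U \<phi> N V \<psi> "U \<inter> f -` V"] atlas_Cr_chart M N) auto
  qed
next
  assume f: "\<forall>x\<in>points M. Cr_near r M N f x"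
  then have cont: "continuous_map (mtop M) (mtop N) f" by (intro Cr_near_continuous[OF M]) auto
  have "Cr_on r (model M) (\<phi> ` (U \<inter> f -` V)) (\<psi> \<circ> f \<circ> inv_into U \<phi>)"
    if UV: "(U, \<phi>) \<in> atlas M" "(V, \<psi>) \<in> atlas N" for U \<phi> V \<psi>
  proof (rule Cr_on_local)
    have cU: "Cr_chart r M U \<phi>" and cV: "Cr_chart r N V \<psi>" using UV M N atlas_Cr_chart by blast+
    then have tU: "topological_chart M U \<phi>" and tV: "topological_chart N V \<psi>"
      by (auto dest: Cr_chart_topological)
    show "subspace (model M)" using M by (rule Cr_manifold_subspace)
    have "openin (mtop M) {x \<in> points M. f x \<in> V}"
      using openin_continuous_map_preimage[OF cont chart_open[OF tV]] .
    moreover have "U \<inter> f -` V = U \<inter> {x \<in> points M. f x \<in> V}" using chart_subset[OF tU] by auto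
    ultimately have opn: "openin (mtop M) (U \<inter> f -` V)" using chart_open[OF tU] by auto
    show oE: "openin (top_of_set (model M)) (\<phi> ` (U \<inter> f -` V))"
      by (rule chart_image_open[OF tU opn]) auto
    fix y assume "y \<in> \<phi> ` (U \<inter> f -` V)"
    then obtain x where x: "y = \<phi> x" "x \<in> U" "f x \<in> V" by blast
    then have "x \<in> points M" using chart_subset[OF tU] by blast
    then obtain U' \<phi>' V' \<psi>' \<Omega> where c: "Cr_chart r M U' \<phi>'" "Cr_chart r N V' \<psi>'" "openin (mtop M) \<Omega>"
        "x \<in> \<Omega>" "\<Omega> \<subseteq> U'" "f ` \<Omega> \<subseteq> V'" "Cr_on r (model M) (\<phi>' ` \<Omega>) (\<psi>' \<circ> f \<circ> inv_into U' \<phi>')"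
      using f unfolding Cr_near_def by blast
    let ?\<Omega> = "\<Omega> \<inter> (U \<inter> f -` V)"
    have op: "openin (mtop M) ?\<Omega>" using c(3) opn by blast
    have "Cr_on r (model M) (\<phi>' ` ?\<Omega>) (\<psi>' \<circ> f \<circ> inv_into U' \<phi>')"
      by (rule Cr_on_mono[OF c(7)]) auto
    then have "Cr_on r (model M) (\<phi> ` ?\<Omega>) (\<psi> \<circ> f \<circ> inv_into U \<phi>)"
      by (intro Cr_on_change_charts[OF M N c(1) cU c(2) cV op]) (use c in auto)
    moreover have "openin (top_of_set (\<phi> ` (U \<inter> f -` V))) (\<phi> ` ?\<Omega>)"
      by (rule openin_subset_trans[OF chart_image_open[OF tU op]])
        (use openin_imp_subset[OF oE] in auto)
    ultimately show "\<exists>T. openin (top_of_set (\<phi> ` (U \<inter> f -` V))) T \<and> y \<in> T \<and>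
        Cr_on r (model M) T (\<psi> \<circ> f \<circ> inv_into U \<phi>)"
      using x c(4) by blast
  qed
  then show "Cr_map r M N f" using cont unfolding Cr_map_def by blast
qed

lemma Cr_map_compose:
  assumes M: "Cr_manifold r M" and N: "Cr_manifold r N" and P: "Cr_manifold r P"
    and f: "Cr_map r M N f" and g: "Cr_map r N P g"
  shows "Cr_map r M P (\<lambda>x. g (f x))"
  unfolding Cr_map_iff_near[OF M P]
proof
  fix x assume x: "x \<in> points M"
  have cont: "continuous_map (mtop M) (mtop N) f" using f by (simp add: Cr_map_def)
  then have "f x \<in> points N" using x by (auto simp: continuous_map_def)
  then obtain V \<psi> W \<theta> where V: "(V, \<psi>) \<in> atlas N" "f x \<in> V" and W: "(W, \<theta>) \<in> atlas P" "g (f x) \<in> W"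
    and oV: "openin (mtop N) (V \<inter> g -` W)"
    and cg: "Cr_on r (model N) (\<psi> ` (V \<inter> g -` W)) (\<theta> \<circ> g \<circ> inv_into V \<psi>)"
    by (rule Cr_mapE_near[OF N P g])
  obtain U \<phi> where U: "(U, \<phi>) \<in> atlas M" "x \<in> U" using atlas_chart_at[OF M x] by blast
  have cU: "Cr_chart r M U \<phi>" and cW: "Cr_chart r P W \<theta>" using U W M P atlas_Cr_chart by blast+
  have tU: "topological_chart M U \<phi>" and tV: "topological_chart N V \<psi>"
    using U V M N atlas_Cr_chart Cr_chart_topological by blast+
  let ?\<Omega> = "U \<inter> f -` (V \<inter> g -` W)"
  have "openin (mtop M) {x \<in> points M. f x \<in> V \<inter> g -` W}"
    using openin_continuous_map_preimage[OF cont oV] .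
  moreover have "?\<Omega> = U \<inter> {x \<in> points M. f x \<in> V \<inter> g -` W}" using chart_subset[OF tU] by auto
  ultimately have opn: "openin (mtop M) ?\<Omega>" using chart_open[OF tU] by auto
  have inv: "inv_into U \<phi> (\<phi> x) = x" if "x \<in> U" for x
    using chart_inj[OF tU] that by simp
  have inv': "inv_into V \<psi> (\<psi> x) = x" if "x \<in> V" for x
    using chart_inj[OF tV] that by simp
  have cf: "Cr_on r (model M) (\<phi> ` ?\<Omega>) (\<psi> \<circ> f \<circ> inv_into U \<phi>)"
    by (rule Cr_on_mono[of r "model M" "\<phi> ` (U \<inter> f -` V)"])
      (use f U V in \<open>auto simp: Cr_map_def\<close>)
  have "Cr_on r (model M) (\<phi> ` ?\<Omega>) (\<lambda>y. (\<theta> \<circ> g \<circ> inv_into V \<psi>) ((\<psi> \<circ> f \<circ> inv_into U \<phi>) y))"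
    by (rule Cr_on_compose[OF Cr_manifold_subspace[OF M] chart_image_open[OF tU opn]
          Cr_manifold_subspace[OF N] _ _ cf cg])
      (use chart_image_subset[OF tV] in \<open>auto simp: inv\<close>)
  also have "?this \<longleftrightarrow> Cr_on r (model M) (\<phi> ` ?\<Omega>) (\<theta> \<circ> (\<lambda>x. g (f x)) \<circ> inv_into U \<phi>)"
    by (rule Cr_on_cong) (auto simp: inv inv')
  finally show "Cr_near r M P (\<lambda>x. g (f x)) x"
    by (intro Cr_nearI[OF cU cW opn]) (use U V W in auto)
qed

text \<open>Only the germ of \<open>f\<close> at \<open>x\<close> matters: on a smaller open set the
  same pair of charts works for \<open>g\<close>.\<close>

lemma Cr_near_transform:
  assumes f: "Cr_near r M N f x" and \<Omega>: "openin (mtop M) \<Omega>" "x \<in> \<Omega>"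
    and eq: "\<And>y. y \<in> \<Omega> \<Longrightarrow> f y = g y"
  shows "Cr_near r M N g x"
proof -
  obtain U \<phi> V \<psi> \<Omega>' where c: "Cr_chart r M U \<phi>" "Cr_chart r N V \<psi>" "openin (mtop M) \<Omega>'" "x \<in> \<Omega>'"
      "\<Omega>' \<subseteq> U" "f ` \<Omega>' \<subseteq> V" "Cr_on r (model M) (\<phi> ` \<Omega>') (\<psi> \<circ> f \<circ> inv_into U \<phi>)"
    using f unfolding Cr_near_def by blast
  have inv: "inv_into U \<phi> (\<phi> y) = y" if "y \<in> \<Omega>'" for y
    using chart_inj[OF Cr_chart_topological[OF c(1)]] that c by (auto intro!: inv_into_f_f)
  have "Cr_on r (model M) (\<phi> ` (\<Omega> \<inter> \<Omega>')) (\<psi> \<circ> f \<circ> inv_into U \<phi>)"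
    by (rule Cr_on_mono[OF c(7)]) auto
  also have "?this \<longleftrightarrow> Cr_on r (model M) (\<phi> ` (\<Omega> \<inter> \<Omega>')) (\<psi> \<circ> g \<circ> inv_into U \<phi>)"
    by (rule Cr_on_cong) (auto simp: inv eq)
  finally show ?thesis
  proof (rule Cr_nearI[OF c(1,2), rotated -1])
    show "openin (mtop M) (\<Omega> \<inter> \<Omega>')" using \<Omega>(1) c(3) by blast
    show "g ` (\<Omega> \<inter> \<Omega>') \<subseteq> V" using c(6) eq by auto
  qed (use \<Omega> c in auto)
qed

lemma Cr_map_cong:
  assumes M: "Cr_manifold r M" and N: "Cr_manifold r N"
    and eq: "\<And>x. x \<in> points M \<Longrightarrow> f x = g x" and f: "Cr_map r M N f"
  shows "Cr_map r M N g"
  unfolding Cr_map_iff_near[OF M N]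
proof
  fix x assume x: "x \<in> points M"
  then have "Cr_near r M N f x" using f unfolding Cr_map_iff_near[OF M N] by blast
  then show "Cr_near r M N g x" using openin_topspace x eq by (rule Cr_near_transform)
qed

section \<open>The product with the real line\<close>

lemma Cr_on_Pair: "Cr_on r E U f \<Longrightarrow> Cr_on r E U g \<Longrightarrow> Cr_on r E U (\<lambda>x. (f x, g x))"
  unfolding Cr_on_def by (blast intro: Ck_on_Pair)

lemma Cr_on_bounded_linear: "bounded_linear f \<Longrightarrow> Cr_on r E U f"
  unfolding Cr_on_def by (blast intro: Ck_on_bounded_linear)

lemma real_times_simps [simp]:
  "model (real_times M) = UNIV \<times> model M"
  "mtop (real_times M) = prod_topology euclideanreal (mtop M)"
  "atlas (real_times M) = {(UNIV \<times> U, map_prod id \<phi>) |U \<phi>. (U, \<phi>) \<in> atlas M}"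
  by (simp_all add: real_times_def)

lemma map_prod_id_image: "map_prod id \<phi> ` (UNIV \<times> U) = UNIV \<times> \<phi> ` U"
  by (simp add: map_prod_surj_on)

lemma inv_into_map_prod_id:
  assumes "inj_on \<phi> U" "y \<in> \<phi> ` U"
  shows "inv_into (UNIV \<times> U) (map_prod id \<phi>) (t, y) = (t, inv_into U \<phi> y)"
  by (rule inv_into_f_eq)
    (use assms in \<open>auto simp: inj_on_def f_inv_into_f inv_into_into\<close>)

lemma topological_chart_real_times:
  assumes U: "topological_chart M U \<phi>"
  shows "topological_chart (real_times M) (UNIV \<times> U) (map_prod id \<phi>)"
  unfolding topological_chart_def real_times_simps map_prod_id_image
proof (intro conjI)
  show "openin (prod_topology euclideanreal (mtop M)) (UNIV \<times> U)"
    using chart_open[OF U] by (simp add: openin_prod_Times_iff)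
  show "openin (top_of_set (UNIV \<times> model M)) (UNIV \<times> \<phi> ` U)"
    using U by (intro openin_Times) (auto simp: topological_chart_def)
  obtain g where "homeomorphic_maps (subtopology (mtop M) U) (top_of_set (\<phi> ` U)) \<phi> g"
    using U by (auto simp: topological_chart_def homeomorphic_map_maps)
  moreover have "homeomorphic_maps euclideanreal euclideanreal (\<lambda>t. t) (\<lambda>t. t)"
    by (simp add: homeomorphic_maps_def)
  ultimately have "homeomorphic_maps (prod_topology euclideanreal (subtopology (mtop M) U))
      (prod_topology euclideanreal (top_of_set (\<phi> ` U))) (\<lambda>(t, x). (t, \<phi> x)) (\<lambda>(t, x). (t, g x))"
    unfolding homeomorphic_maps_prod by blast
  moreover have "(\<lambda>(t, x). (t, \<phi> x)) = map_prod id \<phi>" by auto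
  moreover have "prod_topology euclideanreal (top_of_set (\<phi> ` U)) = top_of_set (UNIV \<times> \<phi> ` U)"
    using prod_topology_subtopology_eu[of UNIV "\<phi> ` U"] by simp
  moreover have "prod_topology euclideanreal (subtopology (mtop M) U) =
      subtopology (prod_topology euclideanreal (mtop M)) (UNIV \<times> U)"
    by (simp add: prod_topology_subtopology(2))
  ultimately show "homeomorphic_map (subtopology (prod_topology euclideanreal (mtop M)) (UNIV \<times> U))
      (top_of_set (UNIV \<times> \<phi> ` U)) (map_prod id \<phi>)"
    unfolding homeomorphic_map_maps by metis
qed

lemma Cr_on_real_times:
  fixes E :: "'e::euclidean_space set"
  assumes "subspace E" "openin (top_of_set E) S" "Cr_on r E S f"
    and "\<And>t y. y \<in> S \<Longrightarrow> g (t, y) = (t, f y)"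
  shows "Cr_on r ((UNIV :: real set) \<times> E) (UNIV \<times> S) g"
proof -
  have sub: "subspace ((UNIV :: real set) \<times> E)" by (rule subspace_Times) (use assms in auto)
  have op: "openin (top_of_set ((UNIV :: real set) \<times> E)) (UNIV \<times> S)"
    using assms by (intro openin_Times) auto
  have "Cr_on r ((UNIV :: real set) \<times> E) (UNIV \<times> S) (\<lambda>p. (fst p, f (snd p)))"
    by (intro Cr_on_Pair Cr_on_bounded_linear bounded_linear_fst
        Cr_on_compose[OF sub op assms(1) _ _ _ assms(3)] bounded_linear_snd)
      (use openin_imp_subset[OF assms(2)] in auto)
  also have "?this \<longleftrightarrow> ?thesis" by (rule Cr_on_cong) (use assms(4) in auto)
  finally show ?thesis .
qed

lemma Cr_on_real_times_transition:
  assumes M: "Cr_manifold r M" and U: "Cr_chart r M U \<phi>" and V: "Cr_chart r M V \<psi>"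
  shows "Cr_on r ((UNIV :: real set) \<times> model M) (map_prod id \<phi> ` (UNIV \<times> U \<inter> UNIV \<times> V))
    (map_prod id \<psi> \<circ> inv_into (UNIV \<times> U) (map_prod id \<phi>))"
proof -
  note tU = Cr_chart_topological[OF U] and tV = Cr_chart_topological[OF V]
  have "openin (mtop M) (U \<inter> V)" using chart_open[OF tU] chart_open[OF tV] by blast
  then have "openin (top_of_set (model M)) (\<phi> ` (U \<inter> V))" by (rule chart_image_open[OF tU]) auto
  then have "Cr_on r ((UNIV :: real set) \<times> model M) (UNIV \<times> \<phi> ` (U \<inter> V))
      (map_prod id \<psi> \<circ> inv_into (UNIV \<times> U) (map_prod id \<phi>))"
  proof (rule Cr_on_real_times[OF Cr_manifold_subspace[OF M] _ Cr_chart_transition[OF M U V]])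
    fix t :: real and y assume "y \<in> \<phi> ` (U \<inter> V)"
    then have "inv_into (UNIV \<times> U) (map_prod id \<phi>) (t, y) = (t, inv_into U \<phi> y)"
      by (intro inv_into_map_prod_id chart_inj[OF tU]) auto
    then show "(map_prod id \<psi> \<circ> inv_into (UNIV \<times> U) (map_prod id \<phi>)) (t, y) =
        (t, (\<psi> \<circ> inv_into U \<phi>) y)" by simp
  qed
  moreover have "map_prod id \<phi> ` ((UNIV :: real set) \<times> U \<inter> UNIV \<times> V) = UNIV \<times> \<phi> ` (U \<inter> V)"
    unfolding Times_Int_Times by (simp only: Int_UNIV_left map_prod_id_image)
  ultimately show ?thesis by (simp only:)
qed

lemma Cr_chart_real_times:
  assumes M: "Cr_manifold r M" and U: "Cr_chart r M U \<phi>"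
  shows "Cr_chart r (real_times M) (UNIV \<times> U) (map_prod id \<phi>)"
  unfolding Cr_chart_def
proof (intro conjI ballI, goal_cases)
  case 1
  then show ?case using Cr_chart_topological[OF U] by (rule topological_chart_real_times)
next
  case (2 p)
  then obtain V \<psi> where V: "p = (UNIV \<times> V, map_prod id \<psi>)" "(V, \<psi>) \<in> atlas M" by auto
  then have cV: "Cr_chart r M V \<psi>" using M by (simp add: atlas_Cr_chart)
  have "Cr_on r ((UNIV :: real set) \<times> model M) (map_prod id \<psi> ` (UNIV \<times> U \<inter> UNIV \<times> V))
    (map_prod id \<phi> \<circ> inv_into (UNIV \<times> V) (map_prod id \<psi>))"
    using Cr_on_real_times_transition[OF M cV U] by (simp only: Int_commute)
  then show ?case
    using Cr_on_real_times_transition[OF M U cV] V(1) by (simp add: Cr_compatible_def)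
qed

lemma Cr_manifold_real_times:
  assumes M: "Cr_manifold r M"
  shows "Cr_manifold r (real_times M)"
proof -
  have charts: "Cr_chart r (real_times M) (fst p) (snd p)" if "p \<in> atlas (real_times M)" for p
    using that Cr_chart_real_times[OF M] atlas_Cr_chart[OF M] by auto
  have comp: "Cr_compatible r (model (real_times M)) (fst p) (snd p) (fst q) (snd q)"
    if "p \<in> atlas (real_times M)" "q \<in> atlas (real_times M)" for p q
    using Cr_chart_compatible[OF charts[OF that(1)], of "fst q" "snd q"] that(2) by simp
  have top: "topological_chart (real_times M) (fst p) (snd p)" if "p \<in> atlas (real_times M)" for p
    using charts[OF that] by (rule Cr_chart_topological)
  have sub: "subspace (model (real_times M))"
    using Cr_manifold_subspace[OF M] by (simp add: subspace_Times)
  have haus: "Hausdorff_space (mtop (real_times M))"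
    using M by (simp add: Cr_manifold_def Hausdorff_space_prod_topology)
  have cover: "(\<Union>p\<in>atlas (real_times M). fst p) = points (real_times M)"
  proof
    show "(\<Union>p\<in>atlas (real_times M). fst p) \<subseteq> points (real_times M)"
      using chart_subset[OF top] by blast
    show "points (real_times M) \<subseteq> (\<Union>p\<in>atlas (real_times M). fst p)"
    proof
      fix z assume "z \<in> points (real_times M)"
      then have "snd z \<in> points M" by auto
      then obtain U \<phi> where U: "(U, \<phi>) \<in> atlas M" "snd z \<in> U" using atlas_chart_at[OF M] by blast
      then have A: "(UNIV \<times> U, map_prod id \<phi>) \<in> atlas (real_times M)" by auto
      have B: "z \<in> fst (UNIV \<times> U, map_prod id \<phi>)" using U(2) by (simp add: mem_Times_iff)
      show "z \<in> (\<Union>p\<in>atlas (real_times M). fst p)" using A B by (rule UN_I)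
    qed
  qed
  show ?thesis
    unfolding Cr_manifold_def case_prod_beta by (intro conjI ballI sub haus top comp cover)
qed

lemma Cr_map_ident:
  assumes M: "Cr_manifold r M"
  shows "Cr_map r M M (\<lambda>x. x)"
  unfolding Cr_map_iff_near[OF M M]
proof
  fix x assume "x \<in> points M"
  then obtain U \<phi> where U: "(U, \<phi>) \<in> atlas M" "x \<in> U" using atlas_chart_at[OF M] by blast
  have cU: "Cr_chart r M U \<phi>" using atlas_Cr_chart[OF M U(1)] .
  note tU = Cr_chart_topological[OF cU]
  have "Cr_on r (model M) (\<phi> ` U) (\<phi> \<circ> (\<lambda>x. x) \<circ> inv_into U \<phi>)"
    by (subst Cr_on_cong[of _ _ "\<lambda>x. x"])
      (auto simp: inv_into_f_f[OF chart_inj[OF tU]] intro: Cr_on_bounded_linear bounded_linear_ident)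
  then show "Cr_near r M M (\<lambda>x. x) x"
    by (intro Cr_nearI[OF cU cU chart_open[OF tU] U(2)]) auto
qed

lemma Cr_map_snd:
  assumes M: "Cr_manifold r M"
  shows "Cr_map r (real_times M) M snd"
  unfolding Cr_map_iff_near[OF Cr_manifold_real_times[OF M] M]
proof
  fix p assume "p \<in> points (real_times M)"
  then have "snd p \<in> points M" by auto
  then obtain U \<phi> where U: "(U, \<phi>) \<in> atlas M" "snd p \<in> U" using atlas_chart_at[OF M] by blast
  have cU: "Cr_chart r M U \<phi>" using atlas_Cr_chart[OF M U(1)] .
  note tU = Cr_chart_topological[OF cU]
  note cU' = Cr_chart_real_times[OF M cU]
  have "Cr_on r ((UNIV :: real set) \<times> model M) (UNIV \<times> \<phi> ` U) (\<phi> \<circ> snd \<circ> inv_into (UNIV \<times> U) (map_prod id \<phi>))"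
    by (subst Cr_on_cong[of _ _ snd])
      (auto simp: inv_into_map_prod_id[OF chart_inj[OF tU]] inv_into_f_f[OF chart_inj[OF tU]]
        intro: Cr_on_bounded_linear bounded_linear_snd)
  then have "Cr_on r (model (real_times M)) (map_prod id \<phi> ` (UNIV \<times> U))
      (\<phi> \<circ> snd \<circ> inv_into (UNIV \<times> U) (map_prod id \<phi>))"
    by (simp add: map_prod_id_image)
  then show "Cr_near r (real_times M) M snd p"
    by (intro Cr_nearI[OF cU' cU chart_open[OF Cr_chart_topological[OF cU']]])
      (use U in \<open>auto simp: mem_Times_iff\<close>)
qed

text \<open>One construction with two uses: with \<open>G = snd\<close> it reparametrizes an
  isotopy, and with \<open>a\<close> the identity it feeds one family into another.\<close>

lemma Cr_map_time_change:
  assumes M: "Cr_manifold r M" and a: "Cr_on r UNIV UNIV (a :: real \<Rightarrow> real)"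
    and G: "Cr_map r (real_times M) M G"
  shows "Cr_map r (real_times M) (real_times M) (\<lambda>p. (a (fst p), G p))"
proof -
  note M' = Cr_manifold_real_times[OF M]
  show ?thesis
    unfolding Cr_map_iff_near[OF M' M']
  proof
    fix p assume p: "p \<in> points (real_times M)"
    obtain U' \<phi>' V \<psi> where U': "(U', \<phi>') \<in> atlas (real_times M)" "p \<in> U'"
      and V: "(V, \<psi>) \<in> atlas M" "G p \<in> V" and op: "openin (mtop (real_times M)) (U' \<inter> G -` V)"
      and cr: "Cr_on r (model (real_times M)) (\<phi>' ` (U' \<inter> G -` V)) (\<psi> \<circ> G \<circ> inv_into U' \<phi>')"
      by (rule Cr_mapE_near[OF M' M G p])
    then obtain U \<phi> where U: "U' = UNIV \<times> U" "\<phi>' = map_prod id \<phi>" "(U, \<phi>) \<in> atlas M" by auto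
    let ?\<Omega> = "U' \<inter> G -` V"
    have cU: "Cr_chart r (real_times M) U' \<phi>'" by (rule atlas_Cr_chart[OF M' U'(1)])
    have cV: "Cr_chart r (real_times M) (UNIV \<times> V) (map_prod id \<psi>)"
      by (rule Cr_chart_real_times[OF M atlas_Cr_chart[OF M V(1)]])
    note tU = Cr_chart_topological[OF cU]
    have opE: "openin (top_of_set (model (real_times M))) (\<phi>' ` ?\<Omega>)"
      by (rule chart_image_open[OF tU op]) auto
    have fst_inv: "fst (inv_into U' \<phi>' q) = fst q" if q: "q \<in> \<phi>' ` ?\<Omega>" for q
    proof -
      obtain z where "z \<in> U'" "q = \<phi>' z" using q by blast
      then show ?thesis
        using inv_into_f_f[OF chart_inj[OF tU]] U by simp
    qed
    have "Cr_on r (model (real_times M)) (\<phi>' ` ?\<Omega>) (\<lambda>q. (a (fst q), (\<psi> \<circ> G \<circ> inv_into U' \<phi>') q))"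
      by (intro Cr_on_Pair cr Cr_on_compose[OF Cr_manifold_subspace[OF M'] opE subspace_UNIV _ _ _ a]
          Cr_on_bounded_linear bounded_linear_fst) auto
    also have "?this \<longleftrightarrow> Cr_on r (model (real_times M)) (\<phi>' ` ?\<Omega>)
        (map_prod id \<psi> \<circ> (\<lambda>p. (a (fst p), G p)) \<circ> inv_into U' \<phi>')"
      by (rule Cr_on_cong) (simp add: fst_inv)
    finally show "Cr_near r (real_times M) (real_times M) (\<lambda>p. (a (fst p), G p)) p"
      by (intro Cr_nearI[OF cU cV op]) (use U' V in auto)
  qed
qed

section \<open>The group of a foliation\<close>

text \<open>Isolates joint regularity in time and point from invertibility of the single maps, so
  that it can be handled before the latter is known.\<close>

definition Cr_family ::
  "enat \<Rightarrow> ('a, 'e::euclidean_space) manifold \<Rightarrow> (real \<Rightarrow> 'a \<Rightarrow> 'a) \<Rightarrow> bool" where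
  "Cr_family r M f \<longleftrightarrow> Cr_map r (real_times M) M (\<lambda>p. f (fst p) (snd p))"

lemma Cr_family_time_change:
  assumes M: "Cr_manifold r M" and a: "Cr_on r UNIV UNIV (a :: real \<Rightarrow> real)" and f: "Cr_family r M f"
  shows "Cr_family r M (\<lambda>t. f (a t))"
proof -
  note M' = Cr_manifold_real_times[OF M]
  have "Cr_map r (real_times M) M (\<lambda>p. (\<lambda>p. f (fst p) (snd p)) (a (fst p), snd p))"
    by (rule Cr_map_compose[OF M' M' M Cr_map_time_change[OF M a Cr_map_snd[OF M]]])
      (use f in \<open>simp add: Cr_family_def\<close>)
  then show ?thesis by (simp add: Cr_family_def)
qed

lemma Cr_family_compose:
  assumes M: "Cr_manifold r M" and f: "Cr_family r M f" and g: "Cr_family r M g"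
  shows "Cr_family r M (\<lambda>t. compose (points M) (f t) (g t))"
proof -
  note M' = Cr_manifold_real_times[OF M]
  have a: "Cr_on r UNIV UNIV (\<lambda>t :: real. t)" by (intro Cr_on_bounded_linear bounded_linear_ident)
  have "Cr_map r (real_times M) M (\<lambda>p. (\<lambda>p. f (fst p) (snd p)) (fst p, g (fst p) (snd p)))"
    by (rule Cr_map_compose[OF M' M' M Cr_map_time_change[OF M a]])
      (use f g in \<open>simp_all add: Cr_family_def\<close>)
  then show ?thesis
    unfolding Cr_family_def by (rule Cr_map_cong[OF M' M, rotated]) (auto simp: compose_def)
qed

lemma Cr_family_const:
  assumes M: "Cr_manifold r M" and h: "Cr_map r M M h"
  shows "Cr_family r M (\<lambda>t. h)"
  using Cr_map_compose[OF Cr_manifold_real_times[OF M] M M Cr_map_snd[OF M] h]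
  by (simp add: Cr_family_def)

lemma isotopy_iff:
  "isotopy r M f \<longleftrightarrow> Cr_family r M f \<and> (\<forall>t. f t \<in> Diff r M) \<and> f 0 = (\<lambda>x\<in>points M. x)"
  by (simp add: isotopy_def Cr_family_def case_prod_unfold)

section \<open>Subgroups of the group of bijections\<close>

lemma carrier_BijGroup [simp]: "carrier (BijGroup S) = Bij S"
  by (simp add: BijGroup_def)

lemma one_BijGroup [simp]: "\<one>\<^bsub>BijGroup S\<^esub> = (\<lambda>x\<in>S. x)"
  by (simp add: BijGroup_def)

lemma mult_BijGroup: "f \<in> Bij S \<Longrightarrow> g \<in> Bij S \<Longrightarrow> f \<otimes>\<^bsub>BijGroup S\<^esub> g = compose S f g"
  by (simp add: BijGroup_def)

lemma inv_BijGroup_apply: "f \<in> Bij S \<Longrightarrow> x \<in> S \<Longrightarrow> (inv\<^bsub>BijGroup S\<^esub> f) x = inv_into S f x"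
  by (simp add: inv_BijGroup)

text \<open>With the inverse written as a group inverse, closure properties reduce to
  \<open>inv_inv\<close> and \<open>inv_mult_group\<close>.\<close>

lemma Diff_altdef:
  "Diff r M = {f \<in> Bij (points M). Cr_map r M M f \<and> Cr_map r M M (inv\<^bsub>BijGroup (points M)\<^esub> f)}"
  unfolding Diff_def by (auto simp: inv_BijGroup)

lemma subgroup_Diff:
  assumes M: "Cr_manifold r M"
  shows "subgroup (Diff r M) (BijGroup (points M))"
proof -
  interpret group "BijGroup (points M)" by (rule group_BijGroup)
  have id: "Cr_map r M M (\<lambda>x\<in>points M. x)"
    by (rule Cr_map_cong[OF M M _ Cr_map_ident[OF M]]) simp
  have comp: "Cr_map r M M (f \<otimes>\<^bsub>BijGroup (points M)\<^esub> g)"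
    if "f \<in> Bij (points M)" "g \<in> Bij (points M)" "Cr_map r M M f" "Cr_map r M M g" for f g
    unfolding mult_BijGroup[OF that(1,2)]
    by (rule Cr_map_cong[OF M M _ Cr_map_compose[OF M M M that(4,3)]]) (simp add: compose_def)
  show ?thesis
  proof (rule subgroupI)
    show "Diff r M \<subseteq> carrier (BijGroup (points M))" by (auto simp: Diff_altdef)
    have "(\<lambda>x\<in>points M. x) \<in> Diff r M"
      using id one_closed inv_one by (simp add: Diff_altdef)
    then show "Diff r M \<noteq> {}" by blast
  next
    fix f assume "f \<in> Diff r M"
    then show "inv\<^bsub>BijGroup (points M)\<^esub> f \<in> Diff r M"
      using inv_inv[of f] inv_closed[of f] by (simp add: Diff_altdef)
  next
    fix f g assume "f \<in> Diff r M" "g \<in> Diff r M"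
    then show "f \<otimes>\<^bsub>BijGroup (points M)\<^esub> g \<in> Diff r M"
      using inv_mult_group[of f g] m_closed[of f g] inv_closed[of f] inv_closed[of g] comp
      by (simp add: Diff_altdef)
  qed
qed

lemma subgroup_Diff_leaf:
  assumes M: "Cr_manifold r M" and F: "\<Union>\<F> \<subseteq> points M"
  shows "subgroup (Diff_leaf r M \<F>) (BijGroup (points M))"
proof -
  interpret group "BijGroup (points M)" by (rule group_BijGroup)
  interpret D: subgroup "Diff r M" "BijGroup (points M)" by (rule subgroup_Diff[OF M])
  have sub: "L \<subseteq> points M" if "L \<in> \<F>" for L using F that by blast
  show ?thesis
  proof (rule subgroupI)
    show "Diff_leaf r M \<F> \<subseteq> carrier (BijGroup (points M))"
      using D.subset by (auto simp: Diff_leaf_def)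
    have "(\<lambda>x\<in>points M. x) \<in> Diff_leaf r M \<F>"
      using D.one_closed sub by (auto simp: Diff_leaf_def image_iff)
    then show "Diff_leaf r M \<F> \<noteq> {}" by blast
  next
    fix f assume f: "f \<in> Diff_leaf r M \<F>"
    then have fD: "f \<in> Diff r M" and fB: "f \<in> Bij (points M)"
      using D.subset by (auto simp: Diff_leaf_def)
    have "(inv\<^bsub>BijGroup (points M)\<^esub> f) ` L = L" if L: "L \<in> \<F>" for L
    proof -
      have inj: "inj_on f (points M)" using fB by (simp add: Bij_def bij_betw_def)
      have "(inv\<^bsub>BijGroup (points M)\<^esub> f) ` L = inv_into (points M) f ` L"
        using inv_BijGroup_apply[OF fB] sub[OF L] by (intro image_cong) auto
      also have "\<dots> = inv_into (points M) f ` (f ` L)" using f L by (simp add: Diff_leaf_def)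
      also have "\<dots> = L" using inv_into_image_cancel[OF inj sub[OF L]] .
      finally show ?thesis .
    qed
    then show "inv\<^bsub>BijGroup (points M)\<^esub> f \<in> Diff_leaf r M \<F>"
      using D.m_inv_closed[OF fD] by (simp add: Diff_leaf_def)
  next
    fix f g assume f: "f \<in> Diff_leaf r M \<F>" and g: "g \<in> Diff_leaf r M \<F>"
    then have D: "f \<in> Diff r M" "g \<in> Diff r M" and B: "f \<in> Bij (points M)" "g \<in> Bij (points M)"
      using D.subset by (auto simp: Diff_leaf_def)
    have "(f \<otimes>\<^bsub>BijGroup (points M)\<^esub> g) ` L = L" if L: "L \<in> \<F>" for L
    proof -
      have "(f \<otimes>\<^bsub>BijGroup (points M)\<^esub> g) ` L = f ` (g ` L)"
        unfolding mult_BijGroup[OF B] image_image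
        using sub[OF L] by (intro image_cong) (auto simp: compose_def)
      then show ?thesis using f g L by (simp add: Diff_leaf_def)
    qed
    then show "f \<otimes>\<^bsub>BijGroup (points M)\<^esub> g \<in> Diff_leaf r M \<F>"
      using D.m_closed[OF D] by (simp add: Diff_leaf_def)
  qed
qed

lemma alpha_subset: "alpha r M \<F> \<subseteq> Diff_leaf r M \<F>"
  by (auto simp: alpha_def)

lemma alphaI:
  assumes "Cr_family r M f" "f 0 = (\<lambda>x\<in>points M. x)" "\<And>t. f t \<in> Diff_leaf r M \<F>"
    "compactly_supported M f" "f 1 = g"
  shows "g \<in> alpha r M \<F>"
  using assms unfolding alpha_def isotopy_in_def isotopy_iff
  by (auto intro!: exI[of _ f] simp: Diff_leaf_def)

lemma alphaE:
  assumes "g \<in> alpha r M \<F>"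
  obtains f where "Cr_family r M f" "f 0 = (\<lambda>x\<in>points M. x)" "\<And>t. f t \<in> Diff_leaf r M \<F>"
    "compactly_supported M f" "f 1 = g"
  using assms unfolding alpha_def isotopy_in_def isotopy_iff by auto

lemma subgroup_alpha:
  assumes M: "Cr_manifold r M" and F: "\<Union>\<F> \<subseteq> points M"
  shows "subgroup (alpha r M \<F>) (BijGroup (points M))"
proof -
  let ?S = "points M"
  interpret group "BijGroup ?S" by (rule group_BijGroup)
  interpret L: subgroup "Diff_leaf r M \<F>" "BijGroup ?S" by (rule subgroup_Diff_leaf[OF M F])
  have bij: "f \<in> Bij ?S" if "f \<in> Diff_leaf r M \<F>" for f using L.mem_carrier[OF that] by simp
  show ?thesis
  proof (rule subgroupI)
    show "alpha r M \<F> \<subseteq> carrier (BijGroup ?S)" using alpha_subset L.subset by blast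
    have one: "(\<lambda>x\<in>?S. x) \<in> Diff_leaf r M \<F>" using L.one_closed by simp
    then have "Cr_map r M M (\<lambda>x\<in>?S. x)" by (simp add: Diff_leaf_def Diff_def)
    then have "(\<lambda>x\<in>?S. x) \<in> alpha r M \<F>"
      using one by (intro alphaI[where f = "\<lambda>_. \<lambda>x\<in>?S. x"] Cr_family_const[OF M])
        (auto simp: compactly_supported_def intro!: exI[of _ "{}"])
    then show "alpha r M \<F> \<noteq> {}" by blast
  next
    fix g assume "g \<in> alpha r M \<F>"
    then obtain f where f: "Cr_family r M f" "f 0 = (\<lambda>x\<in>?S. x)" "\<And>t. f t \<in> Diff_leaf r M \<F>"
      "compactly_supported M f" "f 1 = g" by (rule alphaE) blast
    let ?i = "inv\<^bsub>BijGroup ?S\<^esub> g"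
    \<comment> \<open>Time is reversed so that the family starts with \<open>?i\<close> after
      \<open>f 1 = g\<close>, which is the identity, and ends with \<open>?i\<close> after
      \<open>f 0\<close>, which is \<open>?i\<close>.\<close>
    define h where "h t = compose ?S ?i (f (1 - t))" for t
    have gL: "g \<in> Diff_leaf r M \<F>" and iL: "?i \<in> Diff_leaf r M \<F>"
      using f(3)[of 1] f(5) L.m_inv_closed by auto
    have h: "h t = ?i \<otimes>\<^bsub>BijGroup ?S\<^esub> f (1 - t)" for t
      unfolding h_def by (rule mult_BijGroup[symmetric]) (use bij f(3) iL in auto)
    show "?i \<in> alpha r M \<F>"
    proof (rule alphaI[of r M h])
      have "Cr_on r UNIV UNIV (\<lambda>t :: real. 1 - t)"
        unfolding Cr_on_def
      proof (intro allI impI)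
        fix k
        have "Ck_on k UNIV UNIV (\<lambda>t :: real. 1 + (- t))"
          by (intro Ck_on_add Ck_on_const Ck_on_bounded_linear bounded_linear_minus bounded_linear_ident)
        then show "Ck_on k UNIV UNIV (\<lambda>t :: real. 1 - t)" by simp
      qed
      moreover have "Cr_map r M M ?i" using iL by (simp add: Diff_leaf_def Diff_def)
      ultimately show "Cr_family r M h"
        unfolding h_def
        by (intro Cr_family_compose[OF M Cr_family_const[OF M] Cr_family_time_change[OF M _ f(1)]])
      show "h 0 = (\<lambda>x\<in>?S. x)" using h[of 0] f(5) l_inv[of g] bij[OF gL] by simp
      show "h 1 = ?i" using h[of 1] f(2) r_one[of ?i] bij[OF iL] by simp
      show "h t \<in> Diff_leaf r M \<F>" for t unfolding h using L.m_closed[OF iL f(3)] .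
      obtain K where K: "compactin (mtop M) K" "\<And>t x. x \<in> ?S - K \<Longrightarrow> f t x = x"
        using f(4) unfolding compactly_supported_def by blast
      \<comment> \<open>\<open>g = f 1\<close> fixes the points off \<open>K\<close>, hence so does
        its inverse, and the same \<open>K\<close> supports \<open>h\<close>.\<close>
      have "h t x = x" if x: "x \<in> ?S - K" for t x
      proof -
        have "g x = x" using K(2)[OF x, of 1] f(5) by simp
        moreover have "inj_on g ?S" using bij[OF gL] by (simp add: Bij_def bij_betw_def)
        ultimately have "inv_into ?S g x = x" using x by (intro inv_into_f_eq) auto
        then show ?thesis
          using K(2)[OF x] x inv_BijGroup_apply[OF bij[OF gL], of x] by (simp add: h_def compose_def)
      qed
      with K(1) show "compactly_supported M h" unfolding compactly_supported_def by blast
    qed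
  next
    fix g1 g2 assume "g1 \<in> alpha r M \<F>" "g2 \<in> alpha r M \<F>"
    obtain f1 where f1: "Cr_family r M f1" "f1 0 = (\<lambda>x\<in>?S. x)" "\<And>t. f1 t \<in> Diff_leaf r M \<F>"
      "compactly_supported M f1" "f1 1 = g1"
      using \<open>g1 \<in> alpha r M \<F>\<close> by (rule alphaE) blast
    obtain f2 where f2: "Cr_family r M f2" "f2 0 = (\<lambda>x\<in>?S. x)" "\<And>t. f2 t \<in> Diff_leaf r M \<F>"
      "compactly_supported M f2" "f2 1 = g2"
      using \<open>g2 \<in> alpha r M \<F>\<close> by (rule alphaE) blast
    define h where "h t = compose ?S (f1 t) (f2 t)" for t
    have h: "h t = f1 t \<otimes>\<^bsub>BijGroup ?S\<^esub> f2 t" for t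
      unfolding h_def by (rule mult_BijGroup[symmetric]) (use bij f1(3) f2(3) in auto)
    show "g1 \<otimes>\<^bsub>BijGroup ?S\<^esub> g2 \<in> alpha r M \<F>"
    proof (rule alphaI[of r M h])
      show "Cr_family r M h" unfolding h_def by (rule Cr_family_compose[OF M f1(1) f2(1)])
      show "h 0 = (\<lambda>x\<in>?S. x)" using h[of 0] f1(2) f2(2) one_closed l_one[OF one_closed] by simp
      show "h 1 = g1 \<otimes>\<^bsub>BijGroup ?S\<^esub> g2" using h[of 1] f1(5) f2(5) by simp
      show "h t \<in> Diff_leaf r M \<F>" for t unfolding h using L.m_closed[OF f1(3) f2(3)] .
      obtain K1 where K1: "compactin (mtop M) K1" "\<And>t x. x \<in> ?S - K1 \<Longrightarrow> f1 t x = x"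
        using f1(4) unfolding compactly_supported_def by blast
      obtain K2 where K2: "compactin (mtop M) K2" "\<And>t x. x \<in> ?S - K2 \<Longrightarrow> f2 t x = x"
        using f2(4) unfolding compactly_supported_def by blast
      have "compactin (mtop M) (K1 \<union> K2)" using K1(1) K2(1) by (rule compactin_Un)
      moreover have "h t x = x" if "x \<in> ?S - (K1 \<union> K2)" for t x
        using that K1(2)[of x t] K2(2)[of x t] by (simp add: h_def compose_def)
      ultimately show "compactly_supported M h" unfolding compactly_supported_def by blast
    qed
  qed
qed

text \<open>Membership in \<open>alpha\<close> asks for an isotopy through leaf preserving maps,
  whereas isotopic connectedness asks for one through \<open>alpha\<close> itself. The gap closes
  because each \<open>f t\<close> is the endpoint of the rescaled isotopy sending \<open>s\<close>
  to \<open>f (s * t)\<close>.\<close>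

lemma isotopy_in_alpha:
  assumes M: "Cr_manifold r M" and f: "Cr_family r M f" "f 0 = (\<lambda>x\<in>points M. x)"
    "\<And>t. f t \<in> Diff_leaf r M \<F>" "compactly_supported M f"
  shows "isotopy_in r M (alpha r M \<F>) f"
proof -
  have "f t \<in> alpha r M \<F>" for t
  proof (rule alphaI)
    have "bounded_linear (\<lambda>s :: real. s * t)" by (rule bounded_linear_mult_left)
    then show "Cr_family r M (\<lambda>s. f (s * t))"
      by (intro Cr_family_time_change[OF M _ f(1)] Cr_on_bounded_linear)
    show "compactly_supported M (\<lambda>s. f (s * t))"
      using f(4) unfolding compactly_supported_def by blast
  qed (use f in simp_all)
  then show ?thesis
    using f by (auto simp: isotopy_in_def isotopy_iff Diff_leaf_def)
qed

lemma alpha_isotopically_connected: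
  assumes M: "Cr_manifold r M" and F: "\<Union>\<F> \<subseteq> points M"
  shows "alpha r M \<F> \<in> isotopically_connected_groups_c r M"
proof -
  interpret group "BijGroup (points M)" by (rule group_BijGroup)
  have "alpha r M \<F> \<subseteq> Diff r M" using alpha_subset by (auto simp: Diff_leaf_def)
  then have "subgroup (alpha r M \<F>) (Diff_group r M)"
    unfolding Diff_group_def by (intro subgroup_incl subgroup_alpha[OF M F] subgroup_Diff[OF M])
  moreover have "\<exists>f. isotopy_in r M (alpha r M \<F>) f \<and> compactly_supported M f \<and> f 1 = g"
    if "g \<in> alpha r M \<F>" for g
    using that by (rule alphaE) (use isotopy_in_alpha[OF M] in blast)
  ultimately show ?thesis by (simp add: isotopically_connected_groups_c_def)
qed

section \<open>Bump functions and shears\<close>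

text \<open>The powers of \<open>inverse z\<close> are included to make the family closed under
  differentiation up to linear combinations: the derivative of \<open>flat n\<close> involves
  \<open>flat (n + 2)\<close> and \<open>flat (n + 1)\<close>. Smoothness of all members is then one
  induction.\<close>

definition flat :: "nat \<Rightarrow> real \<Rightarrow> real" where
  "flat n z = (if z > 0 then exp (- inverse z) * inverse z ^ n else 0)"

text \<open>From the right, the substitution of \<open>inverse z\<close> for the variable turns this
  into the fact that the exponential outgrows every power at infinity.\<close>

lemma flat_tendsto_0: "(flat n \<longlongrightarrow> 0) (at 0)"
proof -
  have "eventually (\<lambda>z. 0 = flat n z) (at_left 0)"
    using eventually_at_left_real[of "-1" 0] by (auto simp: flat_def elim: eventually_mono)
  then have left: "(flat n \<longlongrightarrow> 0) (at_left 0)" by (rule tendsto_eventually[OF eventually_mono]) simp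
  have "((\<lambda>z::real. inverse z ^ n / exp (inverse z)) \<longlongrightarrow> 0) (at_right 0)"
    by (rule filterlim_compose[OF tendsto_power_div_exp_0 filterlim_inverse_at_top_right])
  moreover have "eventually (\<lambda>z. inverse z ^ n / exp (inverse z) = flat n z) (at_right 0)"
    using eventually_at_right_real[of 0 1]
    by (auto simp: flat_def exp_minus field_simps elim: eventually_mono)
  ultimately have "(flat n \<longlongrightarrow> 0) (at_right 0)" by (rule Lim_transform_eventually)
  with left show ?thesis by (simp add: filterlim_at_split)
qed

lemma DERIV_flat:
  "(flat n has_real_derivative flat (Suc (Suc n)) z - real n * flat (Suc n) z) (at z)"
proof -
  consider "z > 0" | "z = 0" | "z < 0" by linarith
  then show ?thesis
  proof cases
    case 1
    \<comment> \<open>Subtraction truncates at \<open>n = 0\<close>, where the factor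
      \<open>real n\<close> makes both sides 0.\<close>
    have pow: "real n * inverse z ^ (n - Suc 0) * (inverse z * inverse z) = real n * inverse z ^ Suc n"
      by (cases n) auto
    have "((\<lambda>z. exp (- inverse z) * inverse z ^ n) has_real_derivative
        exp (- inverse z) * (inverse z * inverse z) * inverse z ^ n
        - exp (- inverse z) * (real n * inverse z ^ (n - Suc 0) * (inverse z * inverse z))) (at z)"
      using 1 by (auto intro!: derivative_eq_intros simp: algebra_simps)
    then have "((\<lambda>z. exp (- inverse z) * inverse z ^ n) has_real_derivative
        flat (Suc (Suc n)) z - real n * flat (Suc n) z) (at z)"
      unfolding pow using 1 by (simp add: flat_def algebra_simps)
    then show ?thesis
      by (rule has_field_derivative_transform_within_open[of _ _ _ "{0<..}"])
        (use 1 in \<open>auto simp: flat_def\<close>)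
  next
    case 2
    \<comment> \<open>Dividing by \<open>h\<close> adds one power of \<open>inverse h\<close>, so
      the difference quotient at 0 is the next member of the family; at \<open>h = 0\<close> the
      convention \<open>x / 0 = 0\<close> agrees with it.\<close>
    have "(\<lambda>h. (flat n (0 + h) - flat n 0) / h) = flat (Suc n)"
      by (auto simp: flat_def divide_inverse)
    with 2 flat_tendsto_0[of "Suc n"] show ?thesis
      by (simp add: has_field_derivative_iff) (simp add: flat_def)
  next
    case 3
    have "((\<lambda>z. 0) has_real_derivative 0) (at z)" by simp
    then have "(flat n has_real_derivative 0) (at z)"
      by (rule has_field_derivative_transform_within_open[of _ _ _ "{..<0}"])
        (use 3 in \<open>auto simp: flat_def\<close>)
    with 3 show ?thesis by (simp add: flat_def)
  qed
qed

lemma continuous_on_flat: "continuous_on S (flat n)"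
  by (intro continuous_at_imp_continuous_on ballI DERIV_isCont[OF DERIV_flat])

lemma Ck_on_flat: "Ck_on k UNIV UNIV (flat n)"
proof (induction k arbitrary: n)
  case 0
  then show ?case by (simp add: continuous_on_flat)
next
  case (Suc k)
  have "Ck_on k UNIV UNIV (\<lambda>z. (flat (Suc (Suc n)) z + (- real n) * flat (Suc n) z) * v)" for v
    by (intro Ck_on_mult Ck_on_add Ck_on_const Suc.IH)
  then show ?case
    using DERIV_flat[of n]
    by (auto simp: has_field_derivative_def
        intro!: exI[of _ "\<lambda>z v. (flat (Suc (Suc n)) z - real n * flat (Suc n) z) * v"])
qed

text \<open>The global bound \<open>B\<close> on the derivative is recorded along with the support
  because it decides how large a shear may be and still be invertible.\<close>

lemma smooth_bump:
  assumes "0 < \<epsilon>"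
  obtains g :: "'e::euclidean_space \<Rightarrow> real" and D B where
    "\<And>k. Ck_on k UNIV UNIV g" "0 < g 0" "\<And>x. \<epsilon> \<le> norm x \<Longrightarrow> g x = 0"
    "\<And>x. (g has_derivative D x) (at x)" "\<And>x v. \<bar>D x v\<bar> \<le> B * norm v" "0 \<le> B"
proof -
  \<comment> \<open>Positive exactly inside the ball of radius \<open>\<epsilon>\<close>, so that
    \<open>flat 0 (q x)\<close> is the classical bump. In \<open>D\<close> only
    \<open>flat 2\<close> appears: the other term in the derivative of \<open>flat 0\<close> carries
    the factor \<open>real 0\<close>.\<close>
  define q where "q x = \<epsilon>\<^sup>2 - x \<bullet> x" for x :: 'e
  define g where "g x = flat 0 (q x)" for x
  define D where "D x v = flat 2 (q x) * (- 2 * (x \<bullet> v))" for x v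
  have q: "q x \<le> 0" if "\<epsilon> \<le> norm x" for x
  proof -
    have "\<epsilon>\<^sup>2 \<le> (norm x)\<^sup>2" using that assms by (intro power_mono) auto
    then show ?thesis by (simp add: q_def power2_norm_eq_inner)
  qed
  have qk: "Ck_on k UNIV UNIV q" for k
  proof -
    have "Ck_on k UNIV UNIV (\<lambda>x :: 'e. \<epsilon>\<^sup>2 + (-1) * (x \<bullet> x))"
      by (intro Ck_on_add Ck_on_mult Ck_on_inner Ck_on_const Ck_on_bounded_linear bounded_linear_ident)
    then show ?thesis by (simp add: q_def[abs_def])
  qed
  have gk: "Ck_on k UNIV UNIV g" for k
    unfolding g_def[abs_def]
    by (rule Ck_on_compose[OF subspace_UNIV _ subspace_UNIV _ _ qk Ck_on_flat]) auto
  have dg: "(g has_derivative D x) (at x)" for x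
  proof -
    have "(q has_derivative (\<lambda>v. - 2 * (x \<bullet> v))) (at x)"
      unfolding q_def[abs_def] by (auto intro!: derivative_eq_intros simp: inner_commute)
    moreover have "(flat 0 has_derivative (\<lambda>v. flat 2 (q x) * v)) (at (q x))"
      using DERIV_flat[of 0 "q x"] by (simp add: has_field_derivative_def numeral_2_eq_2)
    ultimately show ?thesis
      unfolding g_def[abs_def] D_def using has_derivative_compose by blast
  qed
  \<comment> \<open>The Cauchy-Schwarz bound for \<open>D x\<close>: continuous on the closed ball
    and zero outside it, hence bounded globally.\<close>
  define b where "b x = \<bar>flat 2 (q x)\<bar> * (2 * norm x)" for x
  have "continuous_on (cball 0 \<epsilon>) (\<lambda>x. flat 2 (q x))"
    by (rule continuous_on_compose2[OF continuous_on_flat[of UNIV]])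
      (auto simp: q_def intro!: continuous_intros)
  then have "continuous_on (cball 0 \<epsilon>) b"
    unfolding b_def by (auto intro!: continuous_intros)
  then have "bounded (b ` cball 0 \<epsilon>)"
    by (intro compact_imp_bounded compact_continuous_image) auto
  then obtain B where B: "0 < B" "\<And>x. x \<in> cball 0 \<epsilon> \<Longrightarrow> norm (b x) \<le> B"
    unfolding bounded_pos by blast
  have bB: "b x \<le> B" for x
  proof (cases "norm x \<le> \<epsilon>")
    case True
    then show ?thesis using B(2)[of x] by (simp add: dist_norm)
  next
    case False
    then show ?thesis using q[of x] B(1) by (simp add: b_def flat_def)
  qed
  have "\<bar>D x v\<bar> \<le> B * norm v" for x v
  proof -
    have "\<bar>D x v\<bar> = \<bar>flat 2 (q x)\<bar> * 2 * \<bar>x \<bullet> v\<bar>" by (simp add: D_def abs_mult)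
    also have "\<dots> \<le> \<bar>flat 2 (q x)\<bar> * 2 * (norm x * norm v)"
      by (intro mult_left_mono Cauchy_Schwarz_ineq2) auto
    also have "\<dots> = b x * norm v" by (simp add: b_def)
    also have "\<dots> \<le> B * norm v" by (intro mult_right_mono bB) auto
    finally show ?thesis .
  qed
  moreover have "0 < g 0" using assms by (simp add: g_def flat_def q_def)
  moreover have "g x = 0" if "\<epsilon> \<le> norm x" for x using q[OF that] by (simp add: g_def flat_def)
  ultimately show ?thesis using gk dg B(1) that by (metis less_imp_le)
qed

section \<open>Shears in a fixed direction and their inverses\<close>

context
  fixes g :: "'e::euclidean_space \<Rightarrow> real" and D B and u :: 'e
  assumes g: "\<And>k. Ck_on k UNIV UNIV g" and D: "\<And>x. (g has_derivative D x) (at x)"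
    and B: "\<And>x v. \<bar>D x v\<bar> \<le> B * norm v" "0 \<le> B" "B * norm u < 1"
begin

text \<open>By the mean value inequality the perturbation \<open>g x *\<^sub>R u\<close> has
  Lipschitz constant \<open>B * norm u < 1\<close>, so distances shrink at most by the factor
  \<open>1 - B * norm u\<close>. This yields injectivity and, read backwards, a Lipschitz
  inverse.\<close>

lemma shear_expansion: "(1 - B * norm u) * norm (x - y) \<le> norm ((x + g x *\<^sub>R u) - (y + g y *\<^sub>R u))"
proof -
  have "norm (g x - g y) \<le> B * norm (x - y)"
    by (rule differentiable_bound[of UNIV g D])
      (use D B in \<open>auto intro: onorm_le\<close>)
  then have "norm ((g x - g y) *\<^sub>R u) \<le> B * norm (x - y) * norm u"
    by (simp add: mult_right_mono)
  moreover have "norm (x - y) - norm ((g x - g y) *\<^sub>R u) \<le> norm ((x - y) + (g x - g y) *\<^sub>R u)"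
    using norm_diff_ineq by blast
  ultimately show ?thesis by (simp add: algebra_simps)
qed

text \<open>For surjectivity, a preimage of \<open>y\<close> is a fixed point of the map sending
  \<open>x\<close> to \<open>y - g x *\<^sub>R u\<close>, a contraction with constant
  \<open>B * norm u\<close>.\<close>

lemma bij_shear: "bij (\<lambda>x. x + g x *\<^sub>R u)"
proof (rule bijI)
  show "inj (\<lambda>x. x + g x *\<^sub>R u)"
  proof (rule injI)
    fix x y assume "x + g x *\<^sub>R u = y + g y *\<^sub>R u"
    then have "(1 - B * norm u) * norm (x - y) \<le> 0" using shear_expansion[of x y] by simp
    then show "x = y" using B(3) by (simp add: mult_le_0_iff)
  qed
  have "\<exists>x. y = x + g x *\<^sub>R u" for y
  proof -
    have "dist (y - g a *\<^sub>R u) (y - g b *\<^sub>R u) \<le> B * norm u * dist a b" for a b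
    proof -
      have "norm (g a - g b) \<le> B * norm (a - b)"
        by (rule differentiable_bound[of UNIV g D])
          (use D B in \<open>auto intro: onorm_le\<close>)
      then have "norm ((g a - g b) *\<^sub>R u) \<le> B * norm (a - b) * norm u"
        by (simp add: mult_right_mono)
      moreover have "dist (y - g a *\<^sub>R u) (y - g b *\<^sub>R u) = norm ((g a - g b) *\<^sub>R u)"
        by (simp add: dist_norm algebra_simps norm_minus_commute)
      ultimately show ?thesis by (simp add: dist_norm algebra_simps)
    qed
    then obtain x where "y - g x *\<^sub>R u = x"
      using banach_fix_type[of "B * norm u" "\<lambda>x. y - g x *\<^sub>R u"] B by auto
    then show ?thesis by (metis diff_add_cancel)
  qed
  then show "surj (\<lambda>x. x + g x *\<^sub>R u)" by (simp add: surj_def)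
qed

text \<open>The derivative of the inverse is explicit by the Sherman--Morrison formula, so smoothness of
  the inverse follows by induction, without the inverse function theorem.\<close>

lemma has_derivative_inv_shear:
  fixes y :: 'e
  defines "x \<equiv> inv_into UNIV (\<lambda>x. x + g x *\<^sub>R u) y"
  shows "1 + D x u > 0"
    and "(inv_into UNIV (\<lambda>x. x + g x *\<^sub>R u) has_derivative (\<lambda>v. v - (D x v * inverse (1 + D x u)) *\<^sub>R u)) (at y)"
proof -
  let ?h = "\<lambda>x. x + g x *\<^sub>R u"
  have "\<bar>D x u\<bar> \<le> B * norm u" by (rule B(1))
  then show pos: "1 + D x u > 0" using B(3) by linarith
  have hinv: "?h (inv_into UNIV ?h z) = z" for z
    by (rule surj_f_inv_f[OF bij_is_surj[OF bij_shear]])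
  have Dlin: "bounded_linear (D x)" using D by (rule has_derivative_bounded_linear)
  show "(inv_into UNIV ?h has_derivative (\<lambda>v. v - (D x v * inverse (1 + D x u)) *\<^sub>R u)) (at y)"
  proof (rule has_derivative_inverse_basic[where f = ?h and T = UNIV])
    show "(?h has_derivative (\<lambda>v. v + D x v *\<^sub>R u)) (at (inv_into UNIV ?h y))"
      unfolding x_def[symmetric] by (auto intro!: derivative_eq_intros D)
    show "bounded_linear (\<lambda>v. v - (D x v * inverse (1 + D x u)) *\<^sub>R u)"
      by (intro bounded_linear_sub bounded_linear_ident bounded_linear_scaleR_const
          bounded_linear_mult_const Dlin)
    show "(\<lambda>v. v - (D x v * inverse (1 + D x u)) *\<^sub>R u) \<circ> (\<lambda>v. v + D x v *\<^sub>R u) = id"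
    proof
      fix v
      have "D x (v + D x v *\<^sub>R u) = D x v * (1 + D x u)"
        using linear_add[OF bounded_linear.linear[OF Dlin]] linear_scale[OF bounded_linear.linear[OF Dlin]]
        by (simp add: algebra_simps)
      then show "((\<lambda>v. v - (D x v * inverse (1 + D x u)) *\<^sub>R u) \<circ> (\<lambda>v. v + D x v *\<^sub>R u)) v = id v"
        using pos by simp
    qed
    \<comment> \<open>\<open>has_derivative_inverse_basic\<close> requires continuity of the
      inverse, which \<open>shear_expansion\<close> supplies.\<close>
    have "(1 / (1 - B * norm u))-lipschitz_on UNIV (inv_into UNIV ?h)"
    proof (rule lipschitz_onI)
      fix a b
      have "(1 - B * norm u) * norm (inv_into UNIV ?h a - inv_into UNIV ?h b) \<le> norm (a - b)"
        using shear_expansion[of "inv_into UNIV ?h a" "inv_into UNIV ?h b"] by (simp only: hinv)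
      then show "dist (inv_into UNIV ?h a) (inv_into UNIV ?h b) \<le> 1 / (1 - B * norm u) * dist a b"
        using B(3) by (simp add: dist_norm field_simps)
    qed (use B(3) in simp)
    then show "continuous (at y) (inv_into UNIV ?h)"
      using lipschitz_on_continuous_on continuous_on_eq_continuous_at by blast
  qed (use hinv in auto)
qed

text \<open>Bootstrapping: the derivative at \<open>y\<close> involves the inverse only as the point
  at which \<open>D\<close> is evaluated, so an inverse of class C^k has a derivative of class C^k
  by composition.\<close>

lemma Ck_on_inv_shear: "Ck_on k UNIV UNIV (inv_into UNIV (\<lambda>x. x + g x *\<^sub>R u))"
proof (induction k)
  case 0
  then show ?case
    using has_derivative_continuous[OF has_derivative_inv_shear(2)]
    by (simp add: continuous_on_eq_continuous_at)
next
  case (Suc k)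
  let ?hi = "inv_into UNIV (\<lambda>x. x + g x *\<^sub>R u)"
  have op: "openin (top_of_set UNIV) (UNIV :: 'e set)" by simp
  \<comment> \<open>\<open>D\<close> is a given derivative, possibly different from the witness
    inside \<open>Ck_on\<close>; identifying it with \<open>dirder g\<close> transfers the
    regularity of \<open>g\<close> to it.\<close>
  have Dk: "Ck_on k UNIV UNIV (\<lambda>x. D x v)" for v
  proof -
    have "D x v = dirder g x v" for x
      by (rule has_derivative_dirder[OF subspace_UNIV op]) (use D in auto)
    then show ?thesis using g[of "Suc k"] Ck_on_Suc_iff[OF subspace_UNIV op, of k g] by simp
  qed
  have "Ck_on k UNIV UNIV (\<lambda>y. D (?hi y) v)" for v
    by (rule Ck_on_compose[OF subspace_UNIV op subspace_UNIV _ _ Suc.IH Dk]) auto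
  then have "Ck_on k UNIV UNIV
      (\<lambda>y. v + (-1) *\<^sub>R ((D (?hi y) v * inverse (1 + D (?hi y) u)) *\<^sub>R u))" for v
    by (intro Ck_on_add Ck_on_scaleR Ck_on_mult Ck_on_inverse Ck_on_const)
      (use less_imp_neq[OF has_derivative_inv_shear(1)] in metis)+
  then show ?case
    using has_derivative_inv_shear(2)
    by (auto intro!: exI[of _ "\<lambda>y v. v - (D (?hi y) v * inverse (1 + D (?hi y) u)) *\<^sub>R u"])
qed

end

text \<open>A bounded time change with values 0 and 1 at 0 and 1: the shears have to stay diffeomorphisms
  for all times.\<close>

definition time_scale :: "real \<Rightarrow> real" where
  "time_scale t = 2 * t / (1 + t\<^sup>2)"

lemma abs_time_scale_le: "\<bar>time_scale t\<bar> \<le> 1"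
proof -
  have "0 \<le> (\<bar>t\<bar> - 1)\<^sup>2" by simp
  then have "2 * \<bar>t\<bar> \<le> 1 + t\<^sup>2" by (simp add: power2_diff)
  moreover have "0 < 1 + t\<^sup>2" by (simp add: add_pos_nonneg)
  ultimately show ?thesis by (simp add: time_scale_def abs_mult)
qed

lemma time_scale_simps [simp]: "time_scale 0 = 0" "time_scale 1 = 1"
  by (simp_all add: time_scale_def)

lemma Ck_on_time_scale: "Ck_on k UNIV UNIV time_scale"
proof -
  have "1 + t * t \<noteq> 0" for t :: real
    by (metis add_pos_nonneg less_irrefl zero_le_square zero_less_one)
  then have "Ck_on k UNIV UNIV (\<lambda>t :: real. 2 * t * inverse (1 + t * t))"
    by (intro Ck_on_mult Ck_on_inverse Ck_on_add Ck_on_const Ck_on_bounded_linear bounded_linear_ident) auto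
  then show ?thesis by (simp add: time_scale_def[abs_def] divide_inverse power2_eq_square)
qed

section \<open>Extending maps of a chart by the identity\<close>

text \<open>The restriction to \<open>P\<close> makes the result extensional, as elements of
  \<open>Diff\<close> must be.\<close>

definition extend_chart_map ::
  "'a set \<Rightarrow> 'a set \<Rightarrow> ('a \<Rightarrow> 'e) \<Rightarrow> ('e \<Rightarrow> 'e) \<Rightarrow> 'a \<Rightarrow> 'a" where
  "extend_chart_map P U \<phi> h = (\<lambda>x\<in>P. if x \<in> U then inv_into U \<phi> (h (\<phi> x)) else x)"

lemma Cr_map_slice:
  assumes M: "Cr_manifold r M"
  shows "Cr_map r M (real_times M) (\<lambda>x. (t, x))"
  unfolding Cr_map_iff_near[OF M Cr_manifold_real_times[OF M]]
proof
  fix x assume "x \<in> points M"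
  then obtain U \<phi> where U: "(U, \<phi>) \<in> atlas M" "x \<in> U" using atlas_chart_at[OF M] by blast
  have cU: "Cr_chart r M U \<phi>" using atlas_Cr_chart[OF M U(1)] .
  note tU = Cr_chart_topological[OF cU]
  note cU' = Cr_chart_real_times[OF M cU]
  have "Cr_on r (model M) (\<phi> ` U) (\<lambda>y. (t, y))"
    unfolding Cr_on_def using Ck_on_Pair[OF Ck_on_const Ck_on_bounded_linear[OF bounded_linear_ident]]
    by blast
  also have "?this \<longleftrightarrow> Cr_on r (model M) (\<phi> ` U) (map_prod id \<phi> \<circ> (\<lambda>x. (t, x)) \<circ> inv_into U \<phi>)"
    by (rule Cr_on_cong) (auto simp: inv_into_f_f[OF chart_inj[OF tU]])
  finally show "Cr_near r M (real_times M) (\<lambda>x. (t, x)) x"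
    by (intro Cr_nearI[OF cU cU' chart_open[OF tU] U(2)]) auto
qed

lemma Cr_family_slice:
  assumes M: "Cr_manifold r M" and f: "Cr_family r M f"
  shows "Cr_map r M M (f t)"
  using Cr_map_compose[OF M Cr_manifold_real_times[OF M] M Cr_map_slice[OF M] f[unfolded Cr_family_def]]
  by simp

context
  fixes M :: "('a, 'e::euclidean_space) manifold" and r U \<phi>
  assumes M: "Cr_manifold r M" and U: "Cr_chart r M U \<phi>"
begin

private lemma tU: "topological_chart M U \<phi>"
  using U by (rule Cr_chart_topological)

private lemma inv_chart: "x \<in> U \<Longrightarrow> inv_into U \<phi> (\<phi> x) = x"
  using chart_inj[OF tU] by simp

text \<open>Over \<open>U\<close> the representative in the chart is \<open>H\<close> itself; off
  the compact set \<open>K\<close> corresponding to \<open>S\<close> every \<open>f t\<close> is the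
  identity, so the family agrees there with the projection \<open>snd\<close>. The two open regions
  cover everything because \<open>K\<close> lies in \<open>U\<close>.\<close>

lemma Cr_family_extend_chart_map:
  assumes S: "compact S" "S \<subseteq> \<phi> ` U"
    and H: "\<And>t z. z \<in> \<phi> ` U \<Longrightarrow> H t z \<in> \<phi> ` U" "\<And>t z. z \<in> \<phi> ` U - S \<Longrightarrow> H t z = z"
    and smooth: "Cr_on r (UNIV \<times> model M) (UNIV \<times> \<phi> ` U) (\<lambda>p. H (fst p) (snd p))"
  defines "f \<equiv> \<lambda>t. extend_chart_map (points M) U \<phi> (H t)"
  shows "Cr_family r M f" and "compactly_supported M f"
proof -
  define K where "K = inv_into U \<phi> ` S"
  have "compactin (top_of_set (\<phi> ` U)) S" using S by (simp add: compactin_subtopology)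
  then have K: "compactin (mtop M) K"
    unfolding K_def by (rule image_compactin[OF _ chart_inv_continuous[OF tU]])
  \<comment> \<open>Here the Hausdorff property enters: it makes the complement of \<open>K\<close>
    an open neighbourhood of every point outside \<open>U\<close>.\<close>
  have "closedin (mtop M) K"
    using M K by (intro compactin_imp_closedin) (simp_all add: Cr_manifold_def)
  then have opK: "openin (mtop M) (points M - K)" by blast
  have f_id: "f t x = x" if "x \<in> points M - K" for t x
  proof (cases "x \<in> U")
    case True
    then have "\<phi> x \<notin> S" using that inv_chart[OF True] by (force simp: K_def)
    then have "H t (\<phi> x) = \<phi> x" using True by (intro H(2)) auto
    then show ?thesis using that True inv_chart by (simp add: f_def extend_chart_map_def)
  next
    case False
    then show ?thesis using that by (simp add: f_def extend_chart_map_def)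
  qed
  with K show "compactly_supported M f" unfolding compactly_supported_def by blast
  note M' = Cr_manifold_real_times[OF M]
  show "Cr_family r M f"
    unfolding Cr_family_def Cr_map_iff_near[OF M' M]
  proof
    fix p assume p: "p \<in> points (real_times M)"
    show "Cr_near r (real_times M) M (\<lambda>p. f (fst p) (snd p)) p"
    proof (cases "snd p \<in> U")
      case True
      note cU' = Cr_chart_real_times[OF M U]
      have f_U: "f t x = inv_into U \<phi> (H t (\<phi> x))" if "x \<in> U" for t x
        using that chart_subset[OF tU] by (auto simp: f_def extend_chart_map_def)
      have "Cr_on r (UNIV \<times> model M) (UNIV \<times> \<phi> ` U)
          (\<phi> \<circ> (\<lambda>p. f (fst p) (snd p)) \<circ> inv_into (UNIV \<times> U) (map_prod id \<phi>))"
      proof (rule iffD1[OF Cr_on_cong smooth])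
        fix q assume "q \<in> (UNIV :: real set) \<times> \<phi> ` U"
        then obtain t x where q: "q = (t, \<phi> x)" "x \<in> U" by auto
        then have inv: "inv_into (UNIV \<times> U) (map_prod id \<phi>) q = (t, x)"
          using inv_into_map_prod_id[OF chart_inj[OF tU] imageI[OF q(2)]] inv_chart[OF q(2)] by simp
        have "\<phi> (f t x) = H t (\<phi> x)"
          unfolding f_U[OF q(2)] by (rule f_inv_into_f) (use H(1) q(2) in auto)
        then show "H (fst q) (snd q) =
            (\<phi> \<circ> (\<lambda>p. f (fst p) (snd p)) \<circ> inv_into (UNIV \<times> U) (map_prod id \<phi>)) q"
          using inv q(1) by simp
      qed
      then have "Cr_on r (model (real_times M)) (map_prod id \<phi> ` (UNIV \<times> U))
          (\<phi> \<circ> (\<lambda>p. f (fst p) (snd p)) \<circ> inv_into (UNIV \<times> U) (map_prod id \<phi>))"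
        by (simp add: map_prod_id_image)
      moreover have "(\<lambda>p. f (fst p) (snd p)) ` (UNIV \<times> U) \<subseteq> U"
        using f_U H(1) by (auto intro!: inv_into_into)
      ultimately show ?thesis
        by (intro Cr_nearI[OF cU' U chart_open[OF Cr_chart_topological[OF cU']]])
          (use True in \<open>auto simp: mem_Times_iff\<close>)
    next
      case False
      have "K \<subseteq> U" using S(2) by (auto simp: K_def intro: inv_into_into)
      have "Cr_near r (real_times M) M snd p"
        using Cr_map_snd[OF M] p unfolding Cr_map_iff_near[OF M' M] by blast
      then show ?thesis
      proof (rule Cr_near_transform)
        show "openin (mtop (real_times M)) (UNIV \<times> (points M - K))"
          using opK by (simp add: openin_prod_Times_iff)
        show "p \<in> UNIV \<times> (points M - K)" using p False \<open>K \<subseteq> U\<close> by (auto simp: mem_Times_iff)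
        show "snd q = f (fst q) (snd q)" if "q \<in> UNIV \<times> (points M - K)" for q
          using that f_id by (auto simp: mem_Times_iff)
      qed
    qed
  qed
qed

lemma extend_chart_map_in:
  assumes "\<And>z. z \<in> \<phi> ` U \<Longrightarrow> h z \<in> \<phi> ` U" "x \<in> points M"
  shows "extend_chart_map (points M) U \<phi> h x \<in> points M"
    and "extend_chart_map (points M) U \<phi> h x \<in> U \<longleftrightarrow> x \<in> U"
  using assms chart_subset[OF tU] inv_into_into[of _ \<phi> U]
  by (auto simp: extend_chart_map_def)

lemma extend_chart_map_cancel:
  assumes h: "\<And>z. z \<in> \<phi> ` U \<Longrightarrow> h z \<in> \<phi> ` U" and x: "x \<in> points M"
    and cancel: "\<And>z. z \<in> \<phi> ` U \<Longrightarrow> h' (h z) = z"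
  shows "extend_chart_map (points M) U \<phi> h' (extend_chart_map (points M) U \<phi> h x) = x"
proof (cases "x \<in> U")
  case True
  then have "\<phi> (extend_chart_map (points M) U \<phi> h x) = h (\<phi> x)"
    using x h by (auto simp: extend_chart_map_def intro!: f_inv_into_f)
  with True show ?thesis
    using extend_chart_map_in[of h x, OF h x] cancel inv_chart
    by (subst extend_chart_map_def) simp
next
  case False
  then show ?thesis using x by (simp add: extend_chart_map_def)
qed

lemma extend_chart_map_Diff:
  assumes h: "\<And>z. z \<in> \<phi> ` U \<Longrightarrow> h z \<in> \<phi> ` U" "\<And>z. z \<in> \<phi> ` U \<Longrightarrow> h' z \<in> \<phi> ` U"
    and cancel: "\<And>z. z \<in> \<phi> ` U \<Longrightarrow> h' (h z) = z" "\<And>z. z \<in> \<phi> ` U \<Longrightarrow> h (h' z) = z"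
    and smooth: "Cr_map r M M (extend_chart_map (points M) U \<phi> h)"
      "Cr_map r M M (extend_chart_map (points M) U \<phi> h')"
  shows "extend_chart_map (points M) U \<phi> h \<in> Diff r M"
proof -
  let ?f = "extend_chart_map (points M) U \<phi> h" and ?f' = "extend_chart_map (points M) U \<phi> h'"
  have c: "?f' (?f x) = x" "?f (?f' x) = x" "?f x \<in> points M" "?f' x \<in> points M"
    if "x \<in> points M" for x
    using that h cancel by (auto intro: extend_chart_map_cancel extend_chart_map_in(1))
  have bij: "bij_betw ?f (points M) (points M)"
    by (rule bij_betw_byWitness[where f' = ?f']) (use c in auto)
  have "inv_into (points M) ?f x = ?f' x" if "x \<in> points M" for x
    using c that bij by (intro inv_into_f_eq) (auto simp: bij_betw_def)
  then have "Cr_map r M M (\<lambda>x\<in>points M. inv_into (points M) ?f x)"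
    by (intro Cr_map_cong[OF M M _ smooth(2)]) simp
  moreover have "?f \<in> extensional (points M)" by (simp add: extend_chart_map_def)
  ultimately show ?thesis using bij smooth(1) by (simp add: Diff_def Bij_def)
qed

end

text \<open>\<open>h\<close> moves points only in the direction of \<open>E\<^sub>1\<close>, so the
  component in \<open>W\<close> is unchanged, and that component alone decides whether a point of
  the chart lies on \<open>L\<close>. Applied also to the inverse of \<open>h\<close>, the inclusion
  becomes an equality.\<close>

lemma extend_chart_map_leaf:
  assumes M: "Cr_manifold r M" and U: "Cr_chart r M U \<phi>"
    and E: "subspace E\<^sub>1" "E\<^sub>2 \<subseteq> orthogonal_comp E\<^sub>1" "V \<subseteq> E\<^sub>1" "W \<subseteq> E\<^sub>2" "subspace E\<^sub>2"
    and VW: "\<phi> ` U = {v + w |v w. v \<in> V \<and> w \<in> W}"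
    and L: "L \<subseteq> points M"
      "\<phi> ` (L \<inter> U) = {v + l |v l. v \<in> V \<and> l \<in> {w \<in> W. inv_into U \<phi> (0 + w) \<in> L}}"
    and h: "\<And>z. z \<in> \<phi> ` U \<Longrightarrow> h z \<in> \<phi> ` U" "\<And>z. h z - z \<in> E\<^sub>1"
  shows "extend_chart_map (points M) U \<phi> h ` L \<subseteq> L"
proof (rule image_subsetI)
  note tU = Cr_chart_topological[OF U]
  fix x assume x: "x \<in> L"
  show "extend_chart_map (points M) U \<phi> h x \<in> L"
  proof (cases "x \<in> U")
    case True
    then have "\<phi> x \<in> \<phi> ` (L \<inter> U)" using x by blast
    then obtain v w where vw: "\<phi> x = v + w" "v \<in> V" "w \<in> W" "inv_into U \<phi> w \<in> L"
      unfolding L(2) by auto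
    have "h (\<phi> x) \<in> \<phi> ` U" using h(1) True by blast
    then obtain v' w' where vw': "h (\<phi> x) = v' + w'" "v' \<in> V" "w' \<in> W" unfolding VW by blast
    \<comment> \<open>Both the total displacement and its part in \<open>V\<close> lie in
      \<open>E\<^sub>1\<close>, so \<open>w' - w\<close> does too; being also orthogonal to
      \<open>E\<^sub>1\<close>, it vanishes.\<close>
    have "v' - v \<in> E\<^sub>1" using vw vw' E by (intro subspace_diff) auto
    with E(1) h(2)[of "\<phi> x"] have "(h (\<phi> x) - \<phi> x) - (v' - v) \<in> E\<^sub>1" by (rule subspace_diff)
    then have "w' - w \<in> E\<^sub>1" using vw vw' by (simp add: algebra_simps)
    moreover have "w' - w \<in> orthogonal_comp E\<^sub>1"
      using subspace_diff[OF E(5)] vw vw' E by blast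
    ultimately have "orthogonal (w' - w) (w' - w)" by (auto simp: orthogonal_comp_def)
    then have "w' = w" by (simp add: orthogonal_self)
    then have "h (\<phi> x) \<in> \<phi> ` (L \<inter> U)" unfolding L(2) using vw vw' by auto
    then obtain y where "y \<in> L" "y \<in> U" "h (\<phi> x) = \<phi> y" by blast
    then show ?thesis
      using True x L(1) inv_into_f_f[OF chart_inj[OF tU]] by (auto simp: extend_chart_map_def)
  next
    case False
    then show ?thesis using x L(1) by (auto simp: extend_chart_map_def)
  qed
qed

section \<open>Plaques are open in the leaf topology\<close>

lemma locally_connected_openin_subspace:
  fixes E :: "'e::euclidean_space set"
  assumes "subspace E" "openin (top_of_set E) V"
  shows "locally_connected_space (top_of_set V)"
  unfolding locally_connected_space
proof (intro allI impI)
  fix T x assume T: "openin (top_of_set V) T \<and> x \<in> T"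
  then have TE: "openin (top_of_set E) T" using assms(2) openin_trans by blast
  then obtain e where e: "0 < e" "ball x e \<inter> E \<subseteq> T" using T by (auto simp: openin_contains_ball)
  have "connected (ball x e \<inter> E)"
    by (intro convex_connected convex_Int convex_ball subspace_imp_convex assms)
  moreover have sub: "ball x e \<inter> E \<subseteq> V" using e(2) T openin_imp_subset by blast
  moreover have "openin (top_of_set V) (ball x e \<inter> E)"
  proof (rule openin_subset_trans[OF _ sub])
    show "openin (top_of_set E) (ball x e \<inter> E)" by (metis Int_commute open_ball openin_open_Int)
    show "V \<subseteq> E" using assms(2) by (rule openin_imp_subset)
  qed
  moreover have "x \<in> ball x e \<inter> E" using e(1) T openin_imp_subset[OF TE] by auto
  ultimately show "\<exists>U. openin (top_of_set V) U \<and> connectedin (top_of_set V) U \<and> x \<in> U \<and> U \<subseteq> T"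
    using e(2) by (intro exI[of _ "ball x e \<inter> E"]) (auto simp: connectedin_subtopology)
qed

text \<open>Weak imbeddedness makes the map continuous into the topology of \<open>N\<close>, and then invariance of
  domain makes it open.\<close>

lemma weakly_imbedded_open_image:
  fixes N :: "('a, 'e::euclidean_space) manifold" and E :: "'f::euclidean_space set"
  assumes N: "weakly_imbedded r M N" and E: "subspace E" "dim (model N) \<le> dim E"
    and V: "openin (top_of_set E) V"
    and p: "continuous_map (top_of_set V) (mtop M) p" "p ` V \<subseteq> points N" "inj_on p V"
  shows "openin (mtop N) (p ` V)"
proof (subst openin_subopen, intro ballI)
  have N': "Cr_manifold r N" using N by (simp add: weakly_imbedded_def)
  \<comment> \<open>The test space is a subset of \<open>E\<close>, whose type need not be that of
    the points of \<open>M\<close>; hence the appeal to \<open>weakly_imbedded_test\<close>.\<close>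
  have pN: "continuous_map (top_of_set V) (mtop N) p"
    using weakly_imbedded_test[OF N locally_connected_openin_subspace[OF E(1) V] p(1)] p(2) by simp
  fix y assume "y \<in> p ` V"
  then obtain v where v: "v \<in> V" "y = p v" by blast
  then obtain C \<theta> where C: "(C, \<theta>) \<in> atlas N" "y \<in> C" using atlas_chart_at[OF N'] p(2) by blast
  have tC: "topological_chart N C \<theta>" using C N' atlas_Cr_chart Cr_chart_topological by blast
  define V' where "V' = {v \<in> V. p v \<in> C}"
  have "openin (top_of_set V) V'"
    using openin_continuous_map_preimage[OF pN chart_open[OF tC]] by (simp add: V'_def)
  then have V': "openin (top_of_set E) V'" using V openin_trans by blast
  have "continuous_map (top_of_set V') (subtopology (mtop N) C) p"
    using continuous_map_from_subtopology_mono[OF pN, of V']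
    by (intro continuous_map_into_subtopology) (auto simp: V'_def)
  moreover have "continuous_map (subtopology (mtop N) C) (top_of_set (\<theta> ` C)) \<theta>"
    using tC homeomorphic_imp_continuous_map by (auto simp: topological_chart_def)
  ultimately have "continuous_map (top_of_set V') (top_of_set (\<theta> ` C)) (\<theta> \<circ> p)"
    by (rule continuous_map_compose)
  then have cont: "continuous_on V' (\<theta> \<circ> p)" by (simp add: continuous_map_in_subtopology)
  have inj: "inj_on (\<theta> \<circ> p) V'"
    using p(3) chart_inj[OF tC] by (intro comp_inj_on) (auto simp: V'_def inj_on_def)
  \<comment> \<open>Invariance of domain between subspaces needs the dimension of the target not to
    exceed that of the source, which is \<open>E(2)\<close>.\<close>
  have "openin (top_of_set (model N)) ((\<theta> \<circ> p) ` V')"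
    by (rule invariance_of_domain_subspaces[OF V' E(1) Cr_manifold_subspace[OF N'] E(2) cont _ inj])
      (use chart_image_subset[OF tC] in \<open>auto simp: V'_def\<close>)
  then have "openin (top_of_set (\<theta> ` C)) ((\<theta> \<circ> p) ` V')"
    by (rule openin_subset_trans) (use chart_image_subset[OF tC] in \<open>auto simp: V'_def\<close>)
  then have "openin (mtop N) {x \<in> C. \<theta> x \<in> (\<theta> \<circ> p) ` V'}" by (rule chart_vimage_open[OF tC])
  moreover have "{x \<in> C. \<theta> x \<in> (\<theta> \<circ> p) ` V'} = p ` V'"
    using chart_inj[OF tC] by (auto simp: V'_def dest: inj_onD)
  ultimately show "\<exists>T. openin (mtop N) T \<and> y \<in> T \<and> T \<subseteq> p ` V"
    using v C(2) by (intro exI[of _ "p ` V'"]) (auto simp: V'_def)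
qed

section \<open>Accessibility inside the leaves\<close>

lemma accessible_subset_leaf:
  assumes G: "G \<subseteq> Diff_leaf r M \<F>" and L: "L \<in> \<F>" "L \<subseteq> points M" "x \<in> L"
    and y: "y \<in> accessible r M G x"
  shows "y \<in> L"
  using y
proof induction
  case start
  show ?case by (rule L(3))
next
  case (forward y f t)
  then have "f t ` L = L" using G L(1) by (auto simp: isotopy_in_def Diff_leaf_def)
  with forward.IH show ?case by blast
next
  case (backward y f t)
  then have f: "f t ` L = L" "f t \<in> Diff r M" using G L(1) by (auto simp: isotopy_in_def Diff_leaf_def)
  then obtain z where "z \<in> L" "y = f t z" using backward.IH by blast
  \<comment> \<open>\<open>inv_into\<close> picks a preimage in all of \<open>points M\<close>; by
    injectivity it is the point \<open>z\<close> of \<open>L\<close>.\<close>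
  moreover have "inj_on (f t) (points M)" using f(2) by (simp add: Diff_def Bij_def bij_betw_def)
  ultimately show ?case using L(2) by auto
qed

lemma accessible_trans:
  assumes "y \<in> accessible r M G x" "z \<in> accessible r M G y"
  shows "z \<in> accessible r M G x"
  using assms(2) by induction (auto intro: accessible.intros assms(1))

text \<open>A forward step is undone by a backward step and conversely. Membership in
  \<open>points M\<close> is carried through the same induction because \<open>f t\<close> and its
  inverse cancel only there.\<close>

lemma accessible_points_sym:
  assumes y: "y \<in> accessible r M G x" and x: "x \<in> points M"
  shows "y \<in> points M \<and> x \<in> accessible r M G y"
  using y
proof induction
  case start
  show ?case by (simp add: x accessible.start)
next
  case (forward y f t)
  then have "f t \<in> Bij (points M)" by (simp add: isotopy_in_def isotopy_def Diff_def)
  then have "f t y \<in> points M" "inv_into (points M) (f t) (f t y) = y"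
    using forward.IH by (auto simp: Bij_def bij_betw_def)
  moreover have "inv_into (points M) (f t) (f t y) \<in> accessible r M G (f t y)"
    using accessible.start forward.hyps(2) by (rule accessible.backward)
  ultimately show ?case using forward.IH accessible_trans[of y r M G "f t y" x] by simp
next
  case (backward y f t)
  let ?z = "inv_into (points M) (f t) y"
  have "f t \<in> Bij (points M)" using backward by (simp add: isotopy_in_def isotopy_def Diff_def)
  then have "?z \<in> points M" "f t ?z = y"
    using backward.IH by (auto simp: Bij_def bij_betw_def inv_into_into f_inv_into_f)
  moreover have "f t ?z \<in> accessible r M G ?z"
    using accessible.start backward.hyps(2) by (rule accessible.forward)
  ultimately show ?case using backward.IH accessible_trans[of y r M G ?z x] by simp
qed

section \<open>Accessible sets are leaves\<close>

text \<open>The bump function is chosen before \<open>v\<close>, so one radius \<open>\<rho>\<close>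
  serves all directions and a whole neighbourhood of \<open>x\<close> in its plaque is
  reached.\<close>

lemma distinguished_chart_isotopy:
  fixes M :: "('a, 'e::euclidean_space) manifold" and E\<^sub>1 E\<^sub>2 V W :: "'e set"
  assumes M: "Cr_manifold r M" and F: "\<Union>\<F> \<subseteq> points M"
    and U: "Cr_chart r M U \<phi>" "x \<in> U" "\<phi> x = 0"
    and E: "subspace E\<^sub>1" "E\<^sub>1 \<subseteq> model M" "E\<^sub>2 = model M \<inter> orthogonal_comp E\<^sub>1"
    and V: "V \<subseteq> E\<^sub>1" "W \<subseteq> E\<^sub>2"
    and VW: "\<phi> ` U = {v + w |v w. v \<in> V \<and> w \<in> W}"
    and leaves: "\<forall>L\<in>\<F>. \<phi> ` (L \<inter> U) =
      {v + l |v l. v \<in> V \<and> l \<in> {w \<in> W. inv_into U \<phi> (0 + w) \<in> L}}"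
  shows "\<exists>\<rho>>0. \<forall>v\<in>E\<^sub>1. norm v < \<rho> \<longrightarrow>
    (\<exists>f. isotopy_in r M (alpha r M \<F>) f \<and> f 1 x = inv_into U \<phi> v)"
proof -
  note tU = Cr_chart_topological[OF U(1)]
  have subM: "subspace (model M)" using M by (rule Cr_manifold_subspace)
  have E2: "subspace E\<^sub>2" unfolding E(3) using subM by (intro subspace_inter subspace_orthogonal_comp)
  have UE: "\<phi> ` U \<subseteq> model M" using chart_image_subset[OF tU] .
  have "openin (top_of_set (model M)) (\<phi> ` U)" using chart_image_open[OF tU chart_open[OF tU]] by simp
  moreover have "0 \<in> \<phi> ` U" using U(2,3) by (metis imageI)
  ultimately obtain \<epsilon> where \<epsilon>: "0 < \<epsilon>" "cball 0 \<epsilon> \<inter> model M \<subseteq> \<phi> ` U"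
    unfolding openin_contains_cball by blast
  define S where "S = cball 0 \<epsilon> \<inter> model M"
  have S: "compact S" "S \<subseteq> \<phi> ` U"
    using \<epsilon>(2) closed_subspace[OF subM] by (auto simp: S_def intro: compact_Int_closed)
  obtain g :: "'e \<Rightarrow> real" and D B where g: "\<And>k. Ck_on k UNIV UNIV g" "0 < g 0"
    "\<And>z. \<epsilon> \<le> norm z \<Longrightarrow> g z = 0" "\<And>z. (g has_derivative D z) (at z)"
    "\<And>z v. \<bar>D z v\<bar> \<le> B * norm v" "0 \<le> B"
    using smooth_bump[OF \<epsilon>(1)] by metis
  \<comment> \<open>The radius makes \<open>B * norm (u t) < 1\<close> at all times, since
    \<open>norm (u t)\<close> is at most \<open>norm v / g 0\<close>. The summand 1 keeps the
    denominator positive when \<open>B = 0\<close>.\<close>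
  have "\<exists>f. isotopy_in r M (alpha r M \<F>) f \<and> f 1 x = inv_into U \<phi> v"
    if v: "v \<in> E\<^sub>1" "norm v < g 0 / (B + 1)" for v
  proof -
    \<comment> \<open>Division by \<open>g 0\<close> normalizes the shear so that at time 1 it
      carries 0, the image of \<open>x\<close>, exactly to \<open>v\<close>.\<close>
    define u where "u t = (time_scale t / g 0) *\<^sub>R v" for t
    define H where "H t z = z + g z *\<^sub>R u t" for t z
    define H' where "H' t = inv_into UNIV (H t)" for t
    have uE: "u t \<in> E\<^sub>1" for t using v E(1) by (simp add: u_def subspace_scale)
    have small: "B * norm (u t) < 1" for t
    proof -
      have "norm (u t) \<le> norm v / g 0"
        using abs_time_scale_le[of t] g(2)
        by (simp add: u_def abs_mult divide_right_mono mult_left_le_one_le)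
      then have "B * norm (u t) \<le> B * (norm v / g 0)" using g(6) by (rule mult_left_mono)
      also have "\<dots> \<le> (B + 1) * (norm v / g 0)" using g(2) by (intro mult_right_mono) auto
      also have "\<dots> < 1" using v(2) g(2,6) by (simp add: field_simps)
      finally show ?thesis .
    qed
    have bij: "bij (H t)" for t
      unfolding H_def[abs_def] by (rule bij_shear[OF g(1,4,5,6) small])
    have H'H: "H' t (H t z) = z" and HH': "H t (H' t z) = z" for t z
      using bij[of t] by (simp_all add: H'_def bij_is_inj bij_is_surj surj_f_inv_f)
    have H_fix: "H t z = z" if "\<epsilon> \<le> norm z" for t z using g(3)[OF that] by (simp add: H_def)
    have H'_fix: "H' t z = z" if "\<epsilon> \<le> norm z" for t z using H'H[of t z] H_fix[OF that] by simp
    have H_dir: "H t z - z \<in> E\<^sub>1" for t z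
      using subspace_scale[OF E(1) uE[of t]] by (simp add: H_def)
    have H'_dir: "H' t z - z \<in> E\<^sub>1" for t z
      using subspace_neg[OF E(1) H_dir[of t "H' t z"]] by (simp add: HH')
    \<comment> \<open>An injective \<open>h\<close> fixing all points of norm at least
      \<open>\<epsilon>\<close> cannot push an inner point out: the image would be fixed too, hence
      equal to the point itself. Displacements in \<open>E\<^sub>1\<close> remain in the model. The
      argument serves \<open>H t\<close> and \<open>H' t\<close> alike.\<close>
    have stays: "h z \<in> \<phi> ` U"
      if "z \<in> \<phi> ` U" and h: "\<And>z. \<epsilon> \<le> norm z \<Longrightarrow> h z = z" "\<And>z. h z - z \<in> E\<^sub>1" "inj h" for h z
    proof (cases "\<epsilon> \<le> norm z")
      case True
      then show ?thesis using h(1) \<open>z \<in> \<phi> ` U\<close> by simp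
    next
      case False
      have "(h z - z) + z \<in> model M"
        using h(2)[of z] E(2) UE \<open>z \<in> \<phi> ` U\<close> by (intro subspace_add[OF subM]) auto
      then have "h z \<in> model M" by simp
      moreover have "norm (h z) < \<epsilon>"
      proof (rule ccontr)
        assume "\<not> norm (h z) < \<epsilon>"
        then have "h (h z) = h z" by (intro h(1)) simp
        then have "h z = z" using h(3) by (simp add: inj_eq)
        with False \<open>\<not> norm (h z) < \<epsilon>\<close> show False by simp
      qed
      ultimately show ?thesis using \<epsilon>(2) by auto
    qed
    have inj: "inj (H t)" "inj (H' t)" for t
      using bij[of t] HH'[of t] by (auto simp: bij_is_inj intro: inj_on_inverseI[of _ "H t"])
    have H_U: "H t z \<in> \<phi> ` U" and H'_U: "H' t z \<in> \<phi> ` U" if "z \<in> \<phi> ` U" for t z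
      by (rule stays[OF that _ _ inj(1)], use H_fix H_dir in auto)
        (rule stays[OF that _ _ inj(2)], use H'_fix H'_dir in auto)
    have "\<epsilon> \<le> norm z" if "z \<in> \<phi> ` U - S" for z
      using that UE by (auto simp: S_def)
    then have H_S: "H t z = z" and H'_S: "H' t z = z" if "z \<in> \<phi> ` U - S" for t z
      using that H_fix[of z t] H'_fix[of z t] by blast+
    define f where "f t = extend_chart_map (points M) U \<phi> (H t)" for t
    define f' where "f' t = extend_chart_map (points M) U \<phi> (H' t)" for t
    have smooth: "Cr_on r (UNIV \<times> model M) (UNIV \<times> \<phi> ` U) (\<lambda>p. H (fst p) (snd p))"
    proof (rule Cr_on_mono)
      have op: "openin (top_of_set UNIV) (UNIV :: (real \<times> 'e) set)" by simp
      have lin: "Ck_on k UNIV UNIV (fst :: real \<times> 'e \<Rightarrow> real)" "Ck_on k UNIV UNIV (snd :: real \<times> 'e \<Rightarrow> 'e)" for k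
        by (intro Ck_on_bounded_linear bounded_linear_fst bounded_linear_snd)+
      have "Ck_on k UNIV UNIV (\<lambda>p :: real \<times> 'e.
          snd p + (g (snd p) * (time_scale (fst p) * inverse (g 0))) *\<^sub>R v)" for k
        by (intro Ck_on_add Ck_on_scaleR Ck_on_mult Ck_on_const lin
            Ck_on_compose[OF subspace_UNIV op subspace_UNIV _ _ lin(1) Ck_on_time_scale]
            Ck_on_compose[OF subspace_UNIV op subspace_UNIV _ _ lin(2) g(1)]) auto
      then show "Cr_on r UNIV UNIV (\<lambda>p. H (fst p) (snd p))"
        by (simp add: Cr_on_def H_def u_def divide_inverse)
    qed auto
    have smooth': "Cr_on r (UNIV \<times> model M) (UNIV \<times> \<phi> ` U) (\<lambda>p :: real \<times> 'e. H' t (snd p))" for t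
    proof (rule Cr_on_mono)
      have op: "openin (top_of_set UNIV) (UNIV :: (real \<times> 'e) set)" by simp
      have "Ck_on k UNIV UNIV (H' t)" for k
        unfolding H'_def H_def[abs_def] by (rule Ck_on_inv_shear[OF g(1,4,5,6) small])
      then show "Cr_on r UNIV UNIV (\<lambda>p :: real \<times> 'e. H' t (snd p))"
        unfolding Cr_on_def
        using Ck_on_compose[OF subspace_UNIV op subspace_UNIV _ _
            Ck_on_bounded_linear[OF bounded_linear_snd], of UNIV _ "H' t"] by simp
    qed auto
    have fam: "Cr_family r M f" and supp: "compactly_supported M f"
      unfolding f_def[abs_def]
      by (rule Cr_family_extend_chart_map[OF M U(1) S H_U H_S smooth]; assumption)+
    \<comment> \<open>The inverse at a fixed time enters as a constant family, so that the extension
      lemma for families applies; the slice is the map wanted.\<close>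
    have "Cr_family r M (\<lambda>_. f' t)" for t
      unfolding f'_def
      by (rule Cr_family_extend_chart_map(1)[where H = "\<lambda>_. H' t", OF M U(1) S H'_U H'_S smooth'])
    then have smooth_f': "Cr_map r M M (f' t)" for t by (rule Cr_family_slice[OF M])
    have "f t \<in> Diff_leaf r M \<F>" for t
    proof -
      have "f t \<in> Diff r M"
        unfolding f_def
        by (rule extend_chart_map_Diff[OF M U(1) H_U H'_U H'H HH'])
          (use Cr_family_slice[OF M fam, of t] smooth_f'[of t] in \<open>auto simp: f_def f'_def\<close>)
      moreover have "f t ` L = L" if L: "L \<in> \<F>" for L
      proof
        have LM: "L \<subseteq> points M" using F L by blast
        note leaf = extend_chart_map_leaf[OF M U(1) E(1) _ V E2 VW LM leaves[rule_format, OF L]]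
        show "f t ` L \<subseteq> L" unfolding f_def by (rule leaf[OF _ H_U H_dir]) (use E(3) in auto)
        \<comment> \<open>The inverse also moves points along \<open>E\<^sub>1\<close>, which gives
          the opposite inclusion.\<close>
        have f'L: "f' t ` L \<subseteq> L" unfolding f'_def by (rule leaf[OF _ H'_U H'_dir]) (use E(3) in auto)
        have ff': "f t (f' t y) = y" if "y \<in> points M" for y
          unfolding f_def f'_def using that by (intro extend_chart_map_cancel[OF M U(1)] H'_U HH')
        show "L \<subseteq> f t ` L"
        proof
          fix y assume "y \<in> L"
          then have "f' t y \<in> L" "y = f t (f' t y)" using f'L ff'[of y] LM by auto
          then show "y \<in> f t ` L" by (rule rev_image_eqI)
        qed
      qed
      ultimately show ?thesis by (simp add: Diff_leaf_def)
    qed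
    moreover have "f 0 = (\<lambda>x\<in>points M. x)"
      using inv_into_f_f[OF chart_inj[OF tU]]
      by (auto simp: f_def extend_chart_map_def H_def u_def)
    ultimately have "isotopy_in r M (alpha r M \<F>) f"
      using isotopy_in_alpha[OF M fam _ _ supp] by blast
    moreover have "f 1 x = inv_into U \<phi> v"
      using U(2,3) chart_subset[OF tU] g(2) by (auto simp: f_def extend_chart_map_def H_def u_def)
    ultimately show ?thesis by blast
  qed
  moreover have "0 < g 0 / (B + 1)" using g(2,6) by simp
  ultimately show ?thesis by blast
qed

text \<open>The isotopies reach the image of a neighbourhood \<open>V'\<close> of 0 in
  \<open>E\<^sub>1\<close>. As \<open>E\<^sub>1\<close> has the dimension of the model of
  \<open>N\<close>, \<open>weakly_imbedded_open_image\<close> makes that image open in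
  \<open>N\<close>.\<close>

lemma accessible_contains_plaque:
  assumes M: "Cr_manifold r M" and F: "\<F> \<in> foliations r M" and L: "L \<in> \<F>" "x \<in> L"
    and N: "weakly_imbedded r M N" "points N = L" "connected_space (mtop N)"
  shows "\<exists>T. openin (mtop N) T \<and> x \<in> T \<and> T \<subseteq> accessible r M (alpha r M \<F>) x"
proof -
  have part: "partition_on (points M) \<F>" using F by (simp add: foliations_def)
  \<comment> \<open>\<open>foliations\<close> provides a distinguished chart for each
    \<open>k\<close> realized by a structure on \<open>L\<close>; the one matching the given
    \<open>N\<close> is taken.\<close>
  have "leaf_like r M (dim (model N)) L" using N by (auto simp: leaf_like_def)
  then obtain U \<phi> where "distinguished_chart r M \<F> (dim (model N)) x U \<phi>"
    using F L by (simp add: foliations_def) blast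
  then obtain E\<^sub>1 E\<^sub>2 V W where U: "Cr_chart r M U \<phi>" "x \<in> U" "\<phi> x = 0"
    and E: "subspace E\<^sub>1" "E\<^sub>1 \<subseteq> model M" "dim E\<^sub>1 = dim (model N)"
      "E\<^sub>2 = model M \<inter> orthogonal_comp E\<^sub>1"
    and V: "openin (top_of_set E\<^sub>1) V" "openin (top_of_set E\<^sub>2) W"
    and VW: "\<phi> ` U = {v + w |v w. v \<in> V \<and> w \<in> W}"
    and leaves: "\<forall>L\<in>\<F>. \<phi> ` (L \<inter> U) =
      {v + l |v l. v \<in> V \<and> l \<in> {w \<in> W. inv_into U \<phi> (0 + w) \<in> L}}"
    unfolding distinguished_chart_def by (elim exE conjE) (rule that)
  note tU = Cr_chart_topological[OF U(1)]
  have VE: "V \<subseteq> E\<^sub>1" "W \<subseteq> E\<^sub>2" using V openin_imp_subset by blast+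
  have FM: "\<Union>\<F> \<subseteq> points M" using part by (simp add: partition_on_def)
  obtain \<rho> where \<rho>: "0 < \<rho>" "\<forall>v\<in>E\<^sub>1. norm v < \<rho> \<longrightarrow>
    (\<exists>f. isotopy_in r M (alpha r M \<F>) f \<and> f 1 x = inv_into U \<phi> v)"
    using distinguished_chart_isotopy[OF M FM U E(1,2,4) VE VW leaves] by (elim exE conjE) (rule that)
  have "0 \<in> \<phi> ` U" using U(2,3) by (metis imageI)
  \<comment> \<open>\<open>\<phi> x = 0\<close> is a sum of orthogonal vectors from \<open>V\<close>
    and \<open>W\<close>, so both vanish and the plaque of \<open>x\<close> is the one over 0 in
    \<open>W\<close>.\<close>
  then obtain v w where vw: "0 = v + w" "v \<in> V" "w \<in> W" unfolding VW by blast
  have "orthogonal v w" using vw VE E(4) by (auto simp: orthogonal_comp_def)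
  moreover have "w = - v" using vw(1) by (metis add.commute add_eq_0_iff)
  ultimately have "v = 0" "w = 0" by (auto simp: orthogonal_def)
  then have zero: "0 \<in> V" "0 \<in> W" using vw by auto
  have inv0: "inv_into U \<phi> 0 = x" using inv_into_f_f[OF chart_inj[OF tU] U(2)] U(3) by simp
  have VL: "inv_into U \<phi> v \<in> L" and VU: "v \<in> \<phi> ` U" if "v \<in> V" for v
  proof -
    \<comment> \<open>The transverse parameter 0 belongs to \<open>L\<close> because
      \<open>inv_into U \<phi> 0\<close> is \<open>x\<close>; so the whole plaque over it lies in
      \<open>L\<close>.\<close>
    have "v + 0 \<in> \<phi> ` (L \<inter> U)"
      unfolding leaves[rule_format, OF L(1)]
      using that zero(2) inv0 L(2) by (intro CollectI exI[of _ v] exI[of _ 0]) simp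
    then obtain y where y: "y \<in> L" "y \<in> U" "v = \<phi> y" by auto
    then show "v \<in> \<phi> ` U" by blast
    have "inv_into U \<phi> v = y" using inv_into_f_f[OF chart_inj[OF tU] y(2)] y(3) by simp
    with y(1) show "inv_into U \<phi> v \<in> L" by simp
  qed
  define V' where "V' = V \<inter> ball 0 \<rho>"
  have V': "openin (top_of_set E\<^sub>1) V'" unfolding V'_def using V(1) open_ball by (rule openin_Int_open)
  have V'U: "V' \<subseteq> \<phi> ` U"
  proof
    fix v assume "v \<in> V'"
    then show "v \<in> \<phi> ` U" unfolding V'_def by (intro VU) simp
  qed
  have "openin (mtop N) (inv_into U \<phi> ` V')"
  proof (rule weakly_imbedded_open_image[OF N(1) E(1) _ V'])
    show "continuous_map (top_of_set V') (mtop M) (inv_into U \<phi>)"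
      by (rule continuous_map_from_subtopology_mono[OF chart_inv_continuous[OF tU] V'U])
    show "inv_into U \<phi> ` V' \<subseteq> points N"
      unfolding N(2) by (rule image_subsetI) (simp add: V'_def VL)
    show "inj_on (inv_into U \<phi>) V'" by (rule inj_on_inv_into[OF V'U])
  qed (use E(3) in simp)
  moreover have "x \<in> inv_into U \<phi> ` V'"
    using zero(1) \<rho>(1) inv0 by (intro image_eqI[of _ _ 0]) (auto simp: V'_def)
  moreover have "inv_into U \<phi> ` V' \<subseteq> accessible r M (alpha r M \<F>) x"
  proof (rule image_subsetI)
    fix v assume "v \<in> V'"
    then have "v \<in> E\<^sub>1" "norm v < \<rho>" using VE by (auto simp: V'_def)
    then obtain f where f: "isotopy_in r M (alpha r M \<F>) f" "f 1 x = inv_into U \<phi> v"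
      using \<rho>(2) by blast
    from accessible.forward[OF accessible.start f(1), of 1 x] f(2)
    show "inv_into U \<phi> v \<in> accessible r M (alpha r M \<F>) x" by simp
  qed
  ultimately show ?thesis by blast
qed

lemma accessible_alpha_leaf:
  assumes M: "Cr_manifold r M" and F: "\<F> \<in> foliations r M" and L: "L \<in> \<F>" "x \<in> L"
  shows "accessible r M (alpha r M \<F>) x = L"
proof -
  let ?A = "accessible r M (alpha r M \<F>)"
  have LM: "L \<subseteq> points M" using F L(1) by (auto simp: foliations_def partition_on_def)
  have AL: "?A y \<subseteq> L" if "y \<in> L" for y
    using accessible_subset_leaf[OF alpha_subset L(1) LM that] by blast
  obtain k where "leaf_like r M k L" using F L(1) by (auto simp: foliations_def)
  then obtain N where N: "weakly_imbedded r M N" "points N = L" "connected_space (mtop N)"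
    unfolding leaf_like_def by blast
  have nbhd: "\<exists>T. openin (mtop N) T \<and> y \<in> T \<and> T \<subseteq> ?A y" if "y \<in> L" for y
    using accessible_contains_plaque[OF M F L(1) that N] .
  have "openin (mtop N) (?A x)"
  proof (subst openin_subopen, intro ballI)
    fix y assume y: "y \<in> ?A x"
    then have "?A y \<subseteq> ?A x" by (blast intro: accessible_trans)
    with y show "\<exists>T. openin (mtop N) T \<and> y \<in> T \<and> T \<subseteq> ?A x" using nbhd[of y] AL[OF L(2)] by blast
  qed
  \<comment> \<open>By symmetry and transitivity the complement is again a union of accessible sets,
    so openness of all of them also makes \<open>?A x\<close> closed.\<close>
  moreover have "openin (mtop N) (L - ?A x)"
  proof (subst openin_subopen, intro ballI)
    fix y assume y: "y \<in> L - ?A x"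
    have "?A y \<subseteq> L - ?A x"
    proof
      fix z assume z: "z \<in> ?A y"
      have "z \<notin> ?A x"
      proof
        assume "z \<in> ?A x"
        moreover have "y \<in> ?A z" using accessible_points_sym[OF z] y LM by blast
        ultimately show False using accessible_trans[of z r M "alpha r M \<F>" x y] y by blast
      qed
      with z show "z \<in> L - ?A x" using AL y by blast
    qed
    with y show "\<exists>T. openin (mtop N) T \<and> y \<in> T \<and> T \<subseteq> L - ?A x" using nbhd[of y] by blast
  qed
  then have "closedin (mtop N) (?A x)" using N(2) AL[OF L(2)] by (simp add: closedin_def)
  ultimately have "?A x = {} \<or> ?A x = L"
    using N(2,3) unfolding connected_space_clopen_in by blast
  then show ?thesis using accessible.start[of x r M] by blast
qed

lemma beta_alpha:
  assumes M: "Cr_manifold r M" and F: "\<F> \<in> foliations r M"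
  shows "beta r M (alpha r M \<F>) = \<F>"
proof -
  have part: "\<Union>\<F> = points M" "{} \<notin> \<F>" using F by (simp_all add: foliations_def partition_on_def)
  show ?thesis
  proof (intro equalityI subsetI)
    fix A assume "A \<in> beta r M (alpha r M \<F>)"
    then obtain x where x: "x \<in> points M" "A = accessible r M (alpha r M \<F>) x"
      by (auto simp: beta_def)
    then obtain L where "L \<in> \<F>" "x \<in> L" using part(1) by blast
    then show "A \<in> \<F>" using accessible_alpha_leaf[OF M F] x(2) by simp
  next
    fix L assume L: "L \<in> \<F>"
    then obtain x where "x \<in> L" using part(2) by (metis ex_in_conv)
    then have "L = accessible r M (alpha r M \<F>) x" "x \<in> points M"
      using accessible_alpha_leaf[OF M F L] part(1) L by auto
    then show "L \<in> beta r M (alpha r M \<F>)" by (auto simp: beta_def)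
  qed
qed

theorem proposition2p4:
  fixes M :: "('a, 'e::euclidean_space) manifold" and r :: enat
  assumes "Cr_manifold \<infinity> M" and "paracompact_space (mtop M)" and "1 \<le> r"
  shows "alpha r M \<in> foliations r M \<rightarrow> isotopically_connected_groups_c r M
    \<and> (\<forall>\<F>\<in>foliations r M. (beta r M \<circ> alpha r M) \<F> = \<F>)
    \<and> inj_on (alpha r M) (foliations r M)"
proof -
  have M: "Cr_manifold r M" using assms(1) by (rule Cr_manifold_le) simp
  have "\<Union>\<F> \<subseteq> points M" if "\<F> \<in> foliations r M" for \<F>
    using that by (simp add: foliations_def partition_on_def)
  then have "alpha r M \<in> foliations r M \<rightarrow> isotopically_connected_groups_c r M"
    using alpha_isotopically_connected[OF M] by (simp add: Pi_iff)
  moreover have "\<forall>\<F>\<in>foliations r M. (beta r M \<circ> alpha r M) \<F> = \<F>"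
    using beta_alpha[OF M] by simp
  moreover from this have "inj_on (alpha r M) (foliations r M)"
    by (auto intro: inj_on_inverseI[where g = "beta r M"])
  ultimately show ?thesis by blast
qed

end
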